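(* Suppose that $\underline{a}=(a_1,a_2,\ldots,a_n)\in\mathbb{Z}_{\geq 0}^n$ is a non-decreasing sequence. If $B\in\mathcal{H}_n(\mathfrak{o})$ is a reduced form of GK type $\underline{a}$ (i.e. of GK type $(\underline{a},\sigma)$ for some $\underline{a}$-admissible involution $\sigma$), then $\mathrm{GK}(B)=\underline{a}$. In particular, $B$ is optimal.
   Context: $F$ is a non-archimedean local field of characteristic $0$ with ring of integers $\mathfrak{o}$ and normalized valuation $\mathrm{ord}$. $\mathcal{H}_n(\mathfrak{o})$ is the set of symmetric $B=(b_{ij})\in\mathrm{M}_n(F)$ with $b_{ii}\in\mathfrak{o}$, $2b_{ij}\in\mathfrak{o}$; $B[X]={}^tXBX$. For $\underline{a}\in\mathbb{Z}^n$, $\mathcal{M}(\underline{a})=\{B\in\mathcal{H}_n(\mathfrak{o}) : \mathrm{ord}(b_{ii})\ge a_i,\ \mathrm{ord}(2b_{ij})\ge (a_i+a_j)/2\}$. For nondegenerate $B$, $S(B)$ is the set of non-decreasing $\underline{b}\in\mathbb{Z}_{\ge 0}^n$ with $B\in\mathcal{M}(\underline{b})$; the Gross–Keating invariant $\mathrm{GK}(B)$ is the lexicographically greatest element of $\bigcup_{U\in\mathrm{GL}_n(\mathfrak{o})}S(B[U])$, and $B$ is optimal if $\mathrm{GK}(B)\in S(B)$. Blocks $I_1,\ldots,I_r$: the sets of indices $i$ with $a_i$ equal to the 1st, 2nd, ..., $r$-th smallest distinct value. For an involution $\sigma\in\mathfrak{S}_n$: $\mathcal{P}^0=\{i:\sigma(i)=i\}$,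 $\mathcal{P}^+=\{i:a_i>a_{\sigma(i)}\}$, $\mathcal{P}^-=\{i:a_i<a_{\sigma(i)}\}$, $\mathcal{P}^{\ast}_s=\mathcal{P}^\ast\cap I_s$. $\sigma$ is $\underline{a}$-admissible if: (i) $\sharp\mathcal{P}^0\le 2$; two distinct elements $i,j$ of $\mathcal{P}^0$ satisfy $a_i\not\equiv a_j\bmod 2$; if $i\in\mathcal{P}^0$ then $a_i=\max\{a_j: j\in\mathcal{P}^0\cup\mathcal{P}^+, a_j\equiv a_i\bmod 2\}$; (ii) $\sharp\mathcal{P}^+_s\le1$, $\sharp\mathcal{P}^-_s+\sharp\mathcal{P}^0_s\le 1$; (iii) if $i\in\mathcal{P}^-$, $a_{\sigma(i)}=\min\{a_j: j\in\mathcal{P}^+, a_j>a_i, a_j\equiv a_i\bmod 2\}$; if $i\in\mathcal{P}^+$, $a_{\sigma(i)}=\max\{a_j: j\in\mathcal{P}^-, a_j<a_i, a_j\equiv a_i\bmod 2\}$. $B\in\mathcal{M}(\underline{a})$ is a reduced form of GK type $(\underline{a},\sigma)$ if: (1) for $i\notin\mathcal{P}^0$, $j=\sigma(i)$, $a_i\le a_j$: $\mathrm{GK}\begin{pmatrix} b_{ii}&b_{ij}\\ b_{ij}&b_{jj}\end{pmatrix}=(a_i,a_j)$; (2) $i\in\mathcal{P}^0\Rightarrow \mathrm{ord}(b_{ii})=a_i$; (3) $j\ne i,\sigma(i)\Rightarrow\mathrm{ord}(2b_{ij})>(a_i+a_j)/2$. *)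

theory Defs
  imports
    "HOL-Library.Extended_Real"
    "HOL-Combinatorics.Permutations"
    "Jordan_Normal_Form.Determinant"
begin

text \<open>
  A non-archimedean local field of characteristic 0 is a field (of class \<^class>\<open>field_char_0\<close>)
  that is complete for a discrete valuation with finite residue field. The valuation \<open>v\<close> is
  normalized, i.e. it maps the nonzero elements onto the integers, and \<open>v 0 = \<infinity>\<close>.
\<close>

locale nonarch_local_field =
  fixes v :: "'a::field_char_0 \<Rightarrow> ereal"
  assumes v_zero: "v 0 = \<infinity>"
    and v_normalized: "v ` (UNIV - {0}) = range (\<lambda>k::int. ereal (real_of_int k))"
    and v_mult: "v (x * y) = v x + v y"
    and v_add: "min (v x) (v y) \<le> v (x + y)"
    and complete: "(\<And>m::int. \<exists>N. \<forall>i\<ge>N. \<forall>j\<ge>N. ereal m \<le> v (X i - X j)) \<Longrightarrow>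
      \<exists>l. \<forall>m::int. \<exists>N. \<forall>i\<ge>N. ereal m \<le> v (X (i::nat) - l)"
    and finite_residue_field:
      "finite ({x. 0 \<le> v x} // {(x, y). 0 \<le> v x \<and> 0 \<le> v y \<and> 1 \<le> v (x - y)})"

definition integers :: "('a::field_char_0 \<Rightarrow> ereal) \<Rightarrow> 'a set" where
  "integers v = {x. 0 \<le> v x}"

definition half_integral :: "('a::field_char_0 \<Rightarrow> ereal) \<Rightarrow> nat \<Rightarrow> 'a mat set" where
  "half_integral v n = {B \<in> carrier_mat n n. transpose_mat B = B \<and>
     (\<forall>i<n. B $$ (i, i) \<in> integers v) \<and>
     (\<forall>i<n. \<forall>j<n. 2 * B $$ (i, j) \<in> integers v)}"

definition GL_integers :: "('a::field_char_0 \<Rightarrow> ereal) \<Rightarrow> nat \<Rightarrow> 'a mat set" where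
  "GL_integers v n = {U \<in> carrier_mat n n. elements_mat U \<subseteq> integers v \<and>
     (\<exists>V \<in> carrier_mat n n. elements_mat V \<subseteq> integers v \<and> U * V = 1\<^sub>m n \<and> V * U = 1\<^sub>m n)}"

definition form_subst :: "'a::comm_ring_1 mat \<Rightarrow> 'a mat \<Rightarrow> 'a mat" where
  "form_subst B X = transpose_mat X * B * X"

text \<open>
  Elements of \<open>\<int>\<^sup>n\<close> are integer lists of length \<open>n\<close>; all indices start at 0.
\<close>

definition \<M> :: "('a::field_char_0 \<Rightarrow> ereal) \<Rightarrow> int list \<Rightarrow> 'a mat set" where
  "\<M> v a = {B \<in> half_integral v (length a).
     (\<forall>i<length a. ereal (real_of_int (a ! i)) \<le> v (B $$ (i, i))) \<and>
     (\<forall>i<length a. \<forall>j<length a.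
        ereal (real_of_int (a ! i + a ! j) / 2) \<le> v (2 * B $$ (i, j)))}"

definition nondegenerate :: "'a::comm_ring_1 mat \<Rightarrow> bool" where
  "nondegenerate B \<longleftrightarrow> det B \<noteq> 0"

definition S :: "('a::field_char_0 \<Rightarrow> ereal) \<Rightarrow> 'a mat \<Rightarrow> int list set" where
  "S v B = {b. length b = dim_row B \<and> sorted b \<and> (\<forall>x\<in>set b. 0 \<le> x) \<and> B \<in> \<M> v b}"

text \<open>
  For half-integral \<open>B\<close> the lexicographic maximum exists exactly if \<open>B\<close> is nondegenerate; for degenerate \<open>B\<close> the value of
  \<open>GK v B\<close> is unspecified, so every use below is paired with nondegeneracy.
\<close>

definition GK :: "('a::field_char_0 \<Rightarrow> ereal) \<Rightarrow> 'a mat \<Rightarrow> int list" where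
  "GK v B = (let T = (\<Union>U \<in> GL_integers v (dim_row B). S v (form_subst B U))
     in THE a. a \<in> T \<and> (\<forall>b\<in>T. lexordp_eq b a))"

definition optimal :: "('a::field_char_0 \<Rightarrow> ereal) \<Rightarrow> 'a mat \<Rightarrow> bool" where
  "optimal v B \<longleftrightarrow> nondegenerate B \<and> GK v B \<in> S v B"

definition blocks :: "int list \<Rightarrow> nat set set" where
  "blocks a = (\<lambda>c. {i. i < length a \<and> a ! i = c}) ` set a"

definition P_zero :: "int list \<Rightarrow> (nat \<Rightarrow> nat) \<Rightarrow> nat set" where
  "P_zero a \<sigma> = {i. i < length a \<and> \<sigma> i = i}"

definition P_plus :: "int list \<Rightarrow> (nat \<Rightarrow> nat) \<Rightarrow> nat set" where
  "P_plus a \<sigma> = {i. i < length a \<and> a ! i > a ! \<sigma> i}"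

definition P_minus :: "int list \<Rightarrow> (nat \<Rightarrow> nat) \<Rightarrow> nat set" where
  "P_minus a \<sigma> = {i. i < length a \<and> a ! i < a ! \<sigma> i}"

text \<open>
  Used instead of \<^const>\<open>Max\<close> and \<^const>\<open>Min\<close>, whose values on the empty set are arbitrary: an
  equation with the maximum or minimum of a set includes that the set is nonempty.
\<close>

definition is_max_of :: "int \<Rightarrow> int set \<Rightarrow> bool" where
  "is_max_of x A \<longleftrightarrow> x \<in> A \<and> (\<forall>y\<in>A. y \<le> x)"

definition is_min_of :: "int \<Rightarrow> int set \<Rightarrow> bool" where
  "is_min_of x A \<longleftrightarrow> x \<in> A \<and> (\<forall>y\<in>A. x \<le> y)"

definition admissible :: "int list \<Rightarrow> (nat \<Rightarrow> nat) \<Rightarrow> bool" where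
  "admissible a \<sigma> \<longleftrightarrow>
     \<sigma> permutes {..<length a} \<and> \<sigma> \<circ> \<sigma> = id \<and>
     card (P_zero a \<sigma>) \<le> 2 \<and>
     (\<forall>i\<in>P_zero a \<sigma>. \<forall>j\<in>P_zero a \<sigma>. i \<noteq> j \<longrightarrow> a ! i mod 2 \<noteq> a ! j mod 2) \<and>
     (\<forall>i\<in>P_zero a \<sigma>.
        is_max_of (a ! i) {a ! j | j. j \<in> P_zero a \<sigma> \<union> P_plus a \<sigma> \<and> a ! j mod 2 = a ! i mod 2}) \<and>
     (\<forall>I\<in>blocks a. card (P_plus a \<sigma> \<inter> I) \<le> 1 \<and>
        card (P_minus a \<sigma> \<inter> I) + card (P_zero a \<sigma> \<inter> I) \<le> 1) \<and>
     (\<forall>i\<in>P_minus a \<sigma>.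
        is_min_of (a ! \<sigma> i) {a ! j | j. j \<in> P_plus a \<sigma> \<and> a ! j > a ! i \<and> a ! j mod 2 = a ! i mod 2}) \<and>
     (\<forall>i\<in>P_plus a \<sigma>.
        is_max_of (a ! \<sigma> i) {a ! j | j. j \<in> P_minus a \<sigma> \<and> a ! j < a ! i \<and> a ! j mod 2 = a ! i mod 2})"

definition pair_submatrix :: "'a mat \<Rightarrow> nat \<Rightarrow> nat \<Rightarrow> 'a mat" where
  "pair_submatrix B i j =
     mat_of_rows_list 2 [[B $$ (i, i), B $$ (i, j)], [B $$ (i, j), B $$ (j, j)]]"

definition reduced_form ::
  "('a::field_char_0 \<Rightarrow> ereal) \<Rightarrow> int list \<Rightarrow> (nat \<Rightarrow> nat) \<Rightarrow> 'a mat \<Rightarrow> bool" where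
  "reduced_form v a \<sigma> B \<longleftrightarrow> B \<in> \<M> v a \<and>
     (\<forall>i<length a. i \<notin> P_zero a \<sigma> \<and> a ! i \<le> a ! \<sigma> i \<longrightarrow>
        nondegenerate (pair_submatrix B i (\<sigma> i)) \<and>
        GK v (pair_submatrix B i (\<sigma> i)) = [a ! i, a ! \<sigma> i]) \<and>
     (\<forall>i\<in>P_zero a \<sigma>. v (B $$ (i, i)) = ereal (real_of_int (a ! i))) \<and>
     (\<forall>i<length a. \<forall>j<length a. j \<noteq> i \<and> j \<noteq> \<sigma> i \<longrightarrow>
        ereal (real_of_int (a ! i + a ! j) / 2) < v (2 * B $$ (i, j)))"

definition reduced_form_of_GK_type ::
  "('a::field_char_0 \<Rightarrow> ereal) \<Rightarrow> int list \<Rightarrow> 'a mat \<Rightarrow> bool" where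
  "reduced_form_of_GK_type v a B \<longleftrightarrow> (\<exists>\<sigma>. admissible a \<sigma> \<and> reduced_form v a \<sigma> B)"

end

theory Submission
  imports Defs
begin

text \<open>
  Let \<open>B \<in> \<M> b\<close>. In even rank the signed discriminant of \<open>2 B\<close> has the form \<open>x\<^sup>2 + 4 y\<close> with
  \<open>ord x \<ge> \<bar>b\<bar> / 2\<close> and \<open>ord y \<ge> \<bar>b\<bar>\<close>, and in odd rank \<open>det (2 B) / 2\<close> has order at least \<open>\<bar>b\<bar>\<close>.
  If the residual form of \<open>B\<close> relative to \<open>a\<close> is nonsingular, these bounds are sharp for \<open>a\<close>, and
  as the discriminant is invariant up to squares of units, \<open>\<bar>b\<bar> \<le> \<bar>a\<bar>\<close> for every equivalent form in
  \<open>\<M> b\<close>. If some \<open>b\<close> exceeded \<open>a\<close> lexicographically, first at an entry \<open>A\<close> of \<open>a\<close>, then cutting off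
  both sequences at \<open>A + 1\<close> and changing the form modulo elements of order at least \<open>A + 1\<close> would give
  a form with nonsingular residual form that violates this inequality.
\<close>

section \<open>Determinants over finite index sets\<close>

text \<open>The inequality between \<open>\<bar>b\<bar>\<close> and \<open>\<bar>a\<bar>\<close>
  alone says nothing about lexicographic order, hence the cut-off: if \<open>b\<close> first exceeds
  \<open>a\<close> at \<open>A\<close>, monotonicity puts all later entries of \<open>b\<close> at
  \<open>A + 1\<close> or above, so the cut \<open>b\<close> dominates the cut \<open>a\<close>
  entrywise, strictly at that place. The obstacle is that lowering weights can make the residual
  form degenerate. This is repaired by new variables of weight \<open>A + 1\<close>, paired with the
  affected indices through an element of exactly that valuation; they add the same amount to both
  sums. The indices of weight at most \<open>A\<close> that are fixed or lost their partner survive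
  as unary summands. Admissibility forces their parities to be distinct, so at most two survive, and
  with two the total weight is odd. This oddness makes the bound sharp when \<open>2\<close> is not
  a unit: the discriminant is then \<open>x^2 + 4 y\<close>, in which neither term need dominate.
  The conditions on binary blocks enter only through the valuations of a discriminant and of a
  leading coefficient.\<close>

definition list_mat :: "nat list \<Rightarrow> (nat \<Rightarrow> nat \<Rightarrow> 'a) \<Rightarrow> 'a mat" where
  "list_mat xs c = mat (length xs) (length xs) (\<lambda>(i, j). c (xs ! i) (xs ! j))"

text \<open>Elimination removes indices and truncation adds some; determinants over arbitrary finite
  sets of naturals spare any renumbering.\<close>

definition gdet :: "nat set \<Rightarrow> (nat \<Rightarrow> nat \<Rightarrow> 'a::comm_ring_1) \<Rightarrow> 'a" where
  "gdet I c = det (list_mat (sorted_list_of_set I) c)"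

lemma list_mat_carrier [simp]: "list_mat xs c \<in> carrier_mat (length xs) (length xs)"
  by (simp add: list_mat_def)

lemma list_mat_cong:
  assumes "\<And>i j. i \<in> set xs \<Longrightarrow> j \<in> set xs \<Longrightarrow> c i j = d i j"
  shows "list_mat xs c = list_mat xs d"
  using assms by (auto simp: list_mat_def intro!: eq_matI)

text \<open>Rows and columns are permuted by the same \<open>p\<close>, so its sign enters twice and
  cancels. Hence \<open>gdet\<close> may be computed along any enumeration of the index set.\<close>

lemma det_list_mat_perm:
  assumes "mset xs = mset ys"
  shows "det (list_mat xs c) = det (list_mat ys (c :: nat \<Rightarrow> nat \<Rightarrow> 'a::comm_ring_1))"
proof -
  define n where "n = length ys"
  obtain p where p: "p permutes {..<length ys}" "permute_list p ys = xs"
    using mset_eq_permutation[OF assms] by blast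
  have len: "length xs = n" using assms n_def by (metis size_mset)
  have p0: "p permutes {0..<n}" using p(1) by (simp add: n_def lessThan_atLeast0)
  have pn: "p i < n" if "i < n" for i using p0 that permutes_in_image[OF p0, of i] by auto
  have xs: "xs ! i = ys ! (p i)" if "i < n" for i
    using p that n_def permute_list_nth by blast
  let ?M = "list_mat ys c"
  let ?R = "mat n n (\<lambda>(i, j). ?M $$ (p i, j))"
  have M: "?M \<in> carrier_mat n n" by (simp add: n_def)
  have "list_mat xs c = transpose_mat (mat n n (\<lambda>(i, j). (transpose_mat ?R) $$ (p i, j)))"
    using xs len pn by (auto simp: list_mat_def n_def intro!: eq_matI)
  then have "det (list_mat xs c) = det (mat n n (\<lambda>(i, j). (transpose_mat ?R) $$ (p i, j)))"
    using det_transpose[of "mat n n (\<lambda>(i, j). (transpose_mat ?R) $$ (p i, j))" n] by simp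
  also have "\<dots> = signof p * det (transpose_mat ?R)"
    by (rule det_permute_rows[OF _ p0]) simp
  also have "det (transpose_mat ?R) = det ?R"
    by (rule det_transpose[of _ n]) simp
  also have "det ?R = signof p * det ?M" by (rule det_permute_rows[OF M p0])
  finally have "det (list_mat xs c) = (signof p * signof p) * det ?M" by (simp add: mult.assoc)
  moreover have "signof p * signof p = (1::'a)"
    by (cases "evenperm p") (simp_all add: sign_def)
  ultimately show ?thesis by simp
qed

lemma gdet_list:
  assumes "distinct xs" "set xs = I"
  shows "gdet I c = det (list_mat xs c)"
proof -
  have "mset (sorted_list_of_set I) = mset xs"
    using assms by (metis List.finite_set mset_set_set sorted_list_of_set.distinct_sorted_key_list_of_set
      sorted_list_of_set.set_sorted_key_list_of_set)
  then show ?thesis unfolding gdet_def by (rule det_list_mat_perm)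
qed

lemma gdet_cong:
  assumes "finite I" "\<And>i j. i \<in> I \<Longrightarrow> j \<in> I \<Longrightarrow> c i j = d i j"
  shows "gdet I c = gdet I d"
  unfolding gdet_def by (rule arg_cong[where f=det], rule list_mat_cong) (use assms in auto)

lemma det_eq_gdet:
  assumes "A \<in> carrier_mat n n"
  shows "det A = gdet {..<n} (\<lambda>i j. A $$ (i, j))"
proof -
  have "gdet {..<n} (\<lambda>i j. A $$ (i, j)) = det (list_mat [0..<n] (\<lambda>i j. A $$ (i, j)))"
    by (rule gdet_list) auto
  also have "list_mat [0..<n] (\<lambda>i j. A $$ (i, j)) = A"
    using assms by (auto simp: list_mat_def intro!: eq_matI)
  finally show ?thesis by simp
qed

lemma gdet_empty [simp]: "gdet {} c = 1"
  by (subst gdet_list[of "[]"]) (auto simp: list_mat_def)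

lemma gdet_single [simp]: "gdet {i} c = c i i"
  by (subst gdet_list[of "[i]"]) (auto simp: list_mat_def det_single[of _ ])

lemma sum_distinct_list:
  assumes "distinct xs"
  shows "(\<Sum>i\<in>set xs. f i) = (\<Sum>k = 0..<length xs. f (xs ! k))"
proof -
  have "(\<Sum>i\<in>set xs. f i) = sum_list (map f xs)" using assms by (simp add: sum_list_distinct_conv_sum_set)
  also have "\<dots> = (\<Sum>k = 0..<length xs. f (xs ! k))" by (simp add: sum_list_sum_nth)
  finally show ?thesis .
qed

lemma gdet_mult:
  assumes "finite I"
  shows "gdet I (\<lambda>k l. \<Sum>r\<in>I. x k r * y r l) = gdet I x * gdet I (y :: nat \<Rightarrow> nat \<Rightarrow> 'a::idom)"
proof -
  obtain xs where xs: "distinct xs" "set xs = I" using assms finite_distinct_list by blast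
  have "list_mat xs (\<lambda>k l. \<Sum>r\<in>I. x k r * y r l) = list_mat xs x * list_mat xs y"
    unfolding list_mat_def
    by (rule eq_matI) (auto simp: scalar_prod_def sum_distinct_list[OF xs(1)] simp flip: xs(2))
  then show ?thesis using xs det_mult[of "list_mat xs x" "length xs" "list_mat xs y"]
    by (simp add: gdet_list[of xs])
qed

lemma gdet_transpose:
  assumes "finite I"
  shows "gdet I (\<lambda>k l. x l k) = gdet I (x :: nat \<Rightarrow> nat \<Rightarrow> 'a::idom)"
proof -
  obtain xs where xs: "distinct xs" "set xs = I" using assms finite_distinct_list by blast
  have "list_mat xs (\<lambda>k l. x l k) = transpose_mat (list_mat xs x)"
    unfolding list_mat_def by (rule eq_matI) auto
  then show ?thesis using xs det_transpose[of "list_mat xs x" "length xs"]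
    by (simp add: gdet_list[of xs])
qed

lemma gdet_delta:
  assumes "finite I"
  shows "gdet I (\<lambda>k l. if k = l then 1 else 0) = (1 :: 'a::idom)"
proof -
  obtain xs where xs: "distinct xs" "set xs = I" using assms finite_distinct_list by blast
  have "list_mat xs (\<lambda>k l. if k = l then 1 else (0::'a)) = 1\<^sub>m (length xs)"
    unfolding list_mat_def using xs(1) by (intro eq_matI) (auto simp: nth_eq_iff_index_eq)
  then show ?thesis using xs by (simp add: gdet_list[of xs])
qed

lemma gdet_zero:
  assumes "finite I" "I \<noteq> {}" "\<And>k l. k \<in> I \<Longrightarrow> l \<in> I \<Longrightarrow> c k l = 0"
  shows "gdet I c = (0 :: 'a::idom)"
proof -
  obtain xs where xs: "distinct xs" "set xs = I" using assms finite_distinct_list by blast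
  have "list_mat xs c = 0\<^sub>m (length xs) (length xs)"
    unfolding list_mat_def using xs assms(3) by (intro eq_matI) auto
  moreover have "length xs > 0" using xs assms(2) by auto
  ultimately show ?thesis using xs by (simp add: gdet_list[of xs])
qed

lemma gdet_congruence:
  assumes "finite I"
  shows "gdet I (\<lambda>k l. \<Sum>r\<in>I. \<Sum>s\<in>I. u r k * c r s * u s l)
    = (gdet I u)\<^sup>2 * gdet I (c :: nat \<Rightarrow> nat \<Rightarrow> 'a::idom)"
proof -
  have "gdet I (\<lambda>k l. \<Sum>r\<in>I. \<Sum>s\<in>I. u r k * c r s * u s l)
    = gdet I (\<lambda>k l. \<Sum>r\<in>I. (\<lambda>k r. u r k) k r * (\<Sum>s\<in>I. c r s * u s l))"
    by (simp add: sum_distrib_left mult.assoc)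
  also have "\<dots> = gdet I u * (gdet I c * gdet I u)"
    by (subst gdet_mult[OF assms], subst gdet_mult[OF assms], subst gdet_transpose[OF assms]) simp
  finally show ?thesis by (simp add: power2_eq_square mult_ac)
qed

text \<open>With \<open>A\<close> the block on \<open>P\<close> and \<open>X\<close> the matrix of
  \<open>g\<close>, the matrix is the product of a lower block triangular one, with diagonal blocks
  \<open>A\<close> and the Schur complement, and a unipotent one with corner \<open>X\<close>. The
  coefficients are given as a solution of a linear system, so that no inverse matrix occurs.\<close>

lemma gdet_schur:
  fixes c :: "nat \<Rightarrow> nat \<Rightarrow> 'a::idom"
  assumes fin: "finite P" "finite I" and disj: "P \<inter> I = {}"
    and g: "\<And>r l. r \<in> P \<Longrightarrow> l \<in> I \<Longrightarrow> (\<Sum>s\<in>P. c r s * g s l) = c r l"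
  shows "gdet (P \<union> I) c = gdet P c * gdet I (\<lambda>k l. c k l - (\<Sum>s\<in>P. c k s * g s l))"
proof -
  obtain xs where xs: "distinct xs" "set xs = P" using fin finite_distinct_list by blast
  obtain ys where ys: "distinct ys" "set ys = I" using fin finite_distinct_list by blast
  let ?m = "length xs" and ?n = "length ys"
  let ?A = "list_mat xs c" and ?D = "list_mat ys (\<lambda>k l. c k l - (\<Sum>s\<in>P. c k s * g s l))"
  let ?C = "mat ?n ?m (\<lambda>(i, j). c (ys ! i) (xs ! j))"
  let ?X = "mat ?m ?n (\<lambda>(i, j). g (xs ! i) (ys ! j))"
  have carr: "?A \<in> carrier_mat ?m ?m" "?D \<in> carrier_mat ?n ?n" "?C \<in> carrier_mat ?n ?m"
    "?X \<in> carrier_mat ?m ?n" by auto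
  have AX: "?A * ?X = mat ?m ?n (\<lambda>(i, j). c (xs ! i) (ys ! j))"
    unfolding list_mat_def
    by (intro eq_matI) (use g[folded xs(2) ys(2)] in \<open>auto simp: scalar_prod_def sum_distinct_list[OF xs(1)]\<close>)
  have CX: "?C * ?X + ?D = list_mat ys c"
    unfolding list_mat_def
    by (intro eq_matI) (auto simp: scalar_prod_def sum_distinct_list[OF xs(1)] simp flip: xs(2))
  have "list_mat (xs @ ys) c = four_block_mat ?A (mat ?m ?n (\<lambda>(i, j). c (xs ! i) (ys ! j))) ?C (list_mat ys c)"
    by (intro eq_matI) (auto simp: list_mat_def nth_append)
  also have "\<dots> = four_block_mat ?A (0\<^sub>m ?m ?n) ?C ?D * four_block_mat (1\<^sub>m ?m) ?X (0\<^sub>m ?n ?m) (1\<^sub>m ?n)"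
    by (subst mult_four_block_mat[where ?nr1.0="?m" and ?nr2.0="?n" and ?n1.0="?m" and ?n2.0="?n" and ?nc1.0="?m" and ?nc2.0="?n"])
      (use carr AX CX in \<open>auto simp: right_mult_one_mat[OF list_mat_carrier]
        right_mult_zero_mat[OF list_mat_carrier] right_add_zero_mat[OF list_mat_carrier]\<close>)
  finally have "det (list_mat (xs @ ys) c)
    = det (four_block_mat ?A (0\<^sub>m ?m ?n) ?C ?D) * det (four_block_mat (1\<^sub>m ?m) ?X (0\<^sub>m ?n ?m) (1\<^sub>m ?n))"
    using det_mult[of "four_block_mat ?A (0\<^sub>m ?m ?n) ?C ?D" "?m + ?n"] by simp
  also have "det (four_block_mat ?A (0\<^sub>m ?m ?n) ?C ?D) = det ?A * det ?D"
    by (rule det_four_block_mat_upper_right_zero[OF carr(1) refl carr(3,2)])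
  also have "det (four_block_mat (1\<^sub>m ?m) ?X (0\<^sub>m ?n ?m) (1\<^sub>m ?n)) = 1"
    by (subst det_four_block_mat_lower_left_zero[OF _ carr(4) refl]) auto
  finally show ?thesis
    using xs ys disj gdet_list[of "xs @ ys" "P \<union> I" c] gdet_list[of xs P c] gdet_list[of ys I "\<lambda>k l. c k l - (\<Sum>s\<in>P. c k s * g s l)"]
    by simp
qed

lemma gdet_pair:
  fixes c :: "nat \<Rightarrow> nat \<Rightarrow> 'a::idom"
  assumes "i \<noteq> j"
  shows "gdet {i, j} c = c i i * c j j - c i j * c j i"
proof -
  have "gdet {i, j} c = det (list_mat [i, j] c)" by (rule gdet_list) (use assms in auto)
  also have "list_mat [i, j] c = four_block_mat (mat 1 1 (\<lambda>_. c i i)) (mat 1 1 (\<lambda>_. c i j))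
      (mat 1 1 (\<lambda>_. c j i)) (mat 1 1 (\<lambda>_. c j j))"
    by (intro eq_matI) (auto simp: list_mat_def nth_Cons' less_Suc_eq)
  also have "det \<dots> = det (mat 1 1 (\<lambda>_. c i i) * mat 1 1 (\<lambda>_. c j j) - mat 1 1 (\<lambda>_. c i j) * mat 1 1 (\<lambda>_. c j i))"
    by (rule det_four_block_mat[of _ 1]) (auto intro!: eq_matI simp: scalar_prod_def)
  also have "\<dots> = c i i * c j j - c i j * c j i"
    by (subst det_single) (auto simp: scalar_prod_def)
  finally show ?thesis .
qed

section \<open>Valuations\<close>

context nonarch_local_field
begin

definition ge :: "real \<Rightarrow> 'a \<Rightarrow> bool" where "ge t x \<longleftrightarrow> ereal t \<le> v x"
definition gt :: "real \<Rightarrow> 'a \<Rightarrow> bool" where "gt t x \<longleftrightarrow> ereal t < v x"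

lemma v_nonzero_int:
  assumes "x \<noteq> 0"
  obtains k :: int where "v x = ereal (real_of_int k)"
  using v_normalized assms by (metis DiffI UNIV_I image_iff rangeE singletonD)

lemma uniformizer_power:
  obtains x where "v x = ereal (real_of_int k)"
proof -
  have "ereal (real_of_int k) \<in> v ` (UNIV - {0})" by (subst v_normalized) auto
  then obtain x where "v x = ereal (real_of_int k)" by (metis imageE)
  then show ?thesis by (rule that)
qed

lemma v_eq_real_imp_nonzero: "v x = ereal t \<Longrightarrow> x \<noteq> 0"
  using v_zero by auto

lemma v_one [simp]: "v 1 = 0"
proof -
  obtain k :: int where k: "v 1 = ereal (real_of_int k)" by (rule v_nonzero_int[of 1]) auto
  then show ?thesis using v_mult[of 1 1] by (simp add: zero_ereal_def)
qed

lemma v_minus [simp]: "v (- x) = v x"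
proof -
  obtain k :: int where k: "v (-1) = ereal (real_of_int k)" by (rule v_nonzero_int[of "-1"]) auto
  then have "v (-1) = 0" using v_mult[of "-1" "-1"] by (simp add: zero_ereal_def)
  then show ?thesis using v_mult[of "-1" x] by simp
qed

lemma v_mult_real: "v x = ereal s \<Longrightarrow> v y = ereal t \<Longrightarrow> v (x * y) = ereal (s + t)"
  by (simp add: v_mult)

lemma v_inverse: 
  assumes "v x = ereal s"
  shows "v (inverse x) = ereal (- s)"
proof -
  have "v (x * inverse x) = 0" using v_eq_real_imp_nonzero[OF assms] by simp
  moreover obtain t where "v (inverse x) = ereal t"
    using v_nonzero_int[of "inverse x"] v_eq_real_imp_nonzero[OF assms] by auto
  ultimately show ?thesis using assms by (simp add: v_mult zero_ereal_def)
qed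

lemma v_divide: "v x = ereal s \<Longrightarrow> v y = ereal t \<Longrightarrow> v (x / y) = ereal (s - t)"
  using v_mult_real[OF _ v_inverse] by (fastforce simp: divide_inverse)

lemma ge_iff_gt_or: "ge t x \<longleftrightarrow> gt t x \<or> v x = ereal t"
  by (auto simp: ge_def gt_def le_less)

lemma gt_imp_ge: "gt t x \<Longrightarrow> ge t x"
  by (simp add: ge_def gt_def)

lemma ge_eq: "v x = ereal t \<Longrightarrow> ge t x"
  by (simp add: ge_def)

lemma ge_0 [simp]: "ge t 0" and gt_0 [simp]: "gt t 0"
  by (simp_all add: ge_def gt_def v_zero)

lemma ge_1 [simp]: "ge 0 1"
  by (simp add: ge_def)

lemma ge_minus [simp]: "ge t (- x) \<longleftrightarrow> ge t x" and gt_minus [simp]: "gt t (- x) \<longleftrightarrow> gt t x"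
  by (simp_all add: ge_def gt_def)

lemma ge_mono: "ge t x \<Longrightarrow> s \<le> t \<Longrightarrow> ge s x"
  unfolding ge_def by (meson ereal_less_eq(3) order_trans)

lemma gt_mono: "gt t x \<Longrightarrow> s \<le> t \<Longrightarrow> gt s x"
  unfolding gt_def by (meson ereal_less_eq(3) order_le_less_trans)

lemma ge_imp_gt: "ge t x \<Longrightarrow> s < t \<Longrightarrow> gt s x"
  unfolding ge_def gt_def by (meson ereal_less(2) less_ereal.simps(1) order_less_le_trans)

lemma ge_add: "ge t x \<Longrightarrow> ge t y \<Longrightarrow> ge t (x + y)"
  unfolding ge_def using v_add[of x y] by (meson min.boundedI order_trans)

lemma gt_add: "gt t x \<Longrightarrow> gt t y \<Longrightarrow> gt t (x + y)"
  unfolding gt_def using v_add[of x y] by (meson min_less_iff_conj order_less_le_trans)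

lemma ge_diff: "ge t x \<Longrightarrow> ge t y \<Longrightarrow> ge t (x - y)"
  using ge_add[of t x "- y"] by simp

lemma gt_diff: "gt t x \<Longrightarrow> gt t y \<Longrightarrow> gt t (x - y)"
  using gt_add[of t x "- y"] by simp

lemma ge_sum: "(\<And>i. i \<in> A \<Longrightarrow> ge t (f i)) \<Longrightarrow> ge t (sum f A)"
  by (induction A rule: infinite_finite_induct) (auto intro: ge_add)

lemma ge_mult: "ge s x \<Longrightarrow> ge t y \<Longrightarrow> ge (s + t) (x * y)"
  unfolding ge_def v_mult using add_mono[of "ereal s" "v x" "ereal t" "v y"] by simp

lemma ge_mult': "ge s x \<Longrightarrow> ge t y \<Longrightarrow> r \<le> s + t \<Longrightarrow> ge r (x * y)"
  using ge_mult ge_mono by blast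

lemma gt_mult:
  assumes "ge s x" "gt t y"
  shows "gt (s + t) (x * y)"
proof (cases "x = 0 \<or> y = 0")
  case False
  then obtain k l where "v x = ereal k" "v y = ereal l" using v_nonzero_int by metis
  then show ?thesis using assms by (simp add: ge_def gt_def v_mult)
qed auto

lemma gt_mult': "ge s x \<Longrightarrow> gt t y \<Longrightarrow> r \<le> s + t \<Longrightarrow> gt r (x * y)"
  using gt_mult gt_mono by blast

lemma ge_power2: "ge t x \<Longrightarrow> ge (2 * t) (x\<^sup>2)"
  using ge_mult[of t x t x] by (simp add: power2_eq_square)

lemma gt_power2: "gt t x \<Longrightarrow> gt (2 * t) (x\<^sup>2)"
  using gt_mult[of t x t x] by (simp add: power2_eq_square gt_imp_ge)

lemma ge_prod: "(\<And>i. i \<in> A \<Longrightarrow> ge 0 (f i)) \<Longrightarrow> ge 0 (prod f A)"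
proof (induction A rule: infinite_finite_induct)
  case (insert i A)
  then show ?case using ge_mult[of 0 "f i" 0 "prod f A"] by simp
qed auto

lemma ge_divide: "ge s x \<Longrightarrow> v y = ereal t \<Longrightarrow> ge (s - t) (x / y)"
  using ge_mult[OF _ ge_eq[OF v_inverse]] by (fastforce simp: divide_inverse)

lemma gt_divide: "gt s x \<Longrightarrow> v y = ereal t \<Longrightarrow> gt (s - t) (x / y)"
  using gt_mult[OF ge_eq[OF v_inverse], of y t s x] by (simp add: divide_inverse mult.commute)

lemma v_add_gt:
  assumes "v x = ereal t" "gt t y"
  shows "v (x + y) = ereal t"
proof -
  have "ge t (x + y)" using assms by (intro ge_add) (auto simp: ge_eq gt_imp_ge)
  moreover have "\<not> gt t (x + y)"
  proof
    assume "gt t (x + y)"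
    then have "gt t ((x + y) - y)" using assms(2) by (rule gt_diff)
    then show False using assms(1) by (simp add: gt_def)
  qed
  ultimately show ?thesis by (simp add: ge_iff_gt_or)
qed

lemma ge_of_nat [simp]: "ge 0 (of_nat n)"
  by (induction n) (auto intro: ge_add)

lemma ge_2 [simp]: "ge 0 2" and ge_4 [simp]: "ge 0 4"
  using ge_of_nat[of 2] ge_of_nat[of 4] by simp_all

lemma v_2: obtains e :: int where "v 2 = ereal (real_of_int e)" "0 \<le> e"
proof -
  obtain e :: int where e: "v 2 = ereal (real_of_int e)" by (rule v_nonzero_int[of 2]) auto
  with ge_2 show ?thesis using that by (simp add: ge_def)
qed

lemma gt_int_iff: "gt (real_of_int k) x \<longleftrightarrow> ge (real_of_int k + 1) x"
proof (cases "x = 0")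
  case False
  then obtain m :: int where "v x = ereal (real_of_int m)" by (rule v_nonzero_int)
  then show ?thesis by (auto simp: ge_def gt_def)
qed simp

lemma ge_gdet:
  assumes "finite I" "\<And>i j. i \<in> I \<Longrightarrow> j \<in> I \<Longrightarrow> ge 0 (c i j)"
  shows "ge 0 (gdet I c)"
proof -
  obtain xs where xs: "distinct xs" "set xs = I" using assms finite_distinct_list by blast
  have "ge 0 (signof p * (\<Prod>i = 0..<length xs. list_mat xs c $$ (i, p i)))"
    if "p permutes {0..<length xs}" for p
  proof -
    have "ge 0 (\<Prod>i = 0..<length xs. list_mat xs c $$ (i, p i))"
      using that assms(2) xs permutes_in_image[OF that] by (intro ge_prod) (auto simp: list_mat_def)
    then show ?thesis by (cases "evenperm p") (simp_all add: sign_def)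
  qed
  then show ?thesis unfolding gdet_list[OF xs] det_def'[OF list_mat_carrier]
    by (intro ge_sum) auto
qed

text \<open>Both determinants are integral and their product is 1, so neither can have positive
  valuation.\<close>

lemma v_gdet_unit:
  assumes "finite I" "\<And>i j. i \<in> I \<Longrightarrow> j \<in> I \<Longrightarrow> ge 0 (x i j)" "\<And>i j. i \<in> I \<Longrightarrow> j \<in> I \<Longrightarrow> ge 0 (y i j)"
    and inv: "\<And>k l. k \<in> I \<Longrightarrow> l \<in> I \<Longrightarrow> (\<Sum>r\<in>I. x k r * y r l) = (if k = l then 1 else 0)"
  shows "v (gdet I x) = 0"
proof -
  have "gdet I x * gdet I y = gdet I (\<lambda>k l. if k = l then 1 else 0)"
    unfolding gdet_mult[OF assms(1), symmetric] by (rule gdet_cong[OF assms(1)]) (rule inv)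
  then have p: "gdet I x * gdet I y = 1" by (simp add: gdet_delta assms(1))
  then have "gdet I x \<noteq> 0" "gdet I y \<noteq> 0" by auto
  then obtain s t where st: "v (gdet I x) = ereal s" "v (gdet I y) = ereal t"
    using v_nonzero_int by metis
  moreover have "ge 0 (gdet I x)" "ge 0 (gdet I y)" using assms by (auto intro!: ge_gdet)
  moreover have "s + t = 0" using v_mult[of "gdet I x" "gdet I y"] p st by (simp add: zero_ereal_def)
  ultimately show ?thesis by (simp add: ge_def zero_ereal_def)
qed

end

section \<open>Discriminants of forms bounded by weights\<close>

context nonarch_local_field
begin

text \<open>\<open>c\<close> is the matrix of \<open>2 B\<close>: \<open>c i i / 2\<close> is a
  diagonal entry of \<open>B\<close>, and \<open>c i j\<close> is the coefficient of a mixed term of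
  the quadratic form.\<close>

definition form_ge :: "nat set \<Rightarrow> (nat \<Rightarrow> real) \<Rightarrow> (nat \<Rightarrow> nat \<Rightarrow> 'a) \<Rightarrow> bool" where
  "form_ge I w c \<longleftrightarrow> (\<forall>i\<in>I. ge (w i) (c i i / 2)) \<and>
    (\<forall>i\<in>I. \<forall>j\<in>I. c i j = c j i \<and> ge ((w i + w j) / 2) (c i j))"

lemma form_geD:
  assumes "form_ge I w c" "i \<in> I" "j \<in> I"
  shows "ge (w i) (c i i / 2)" "ge ((w i + w j) / 2) (c i j)" "c i j = c j i"
  using assms by (auto simp: form_ge_def)

lemma form_ge_subset: "form_ge I w c \<Longrightarrow> J \<subseteq> I \<Longrightarrow> form_ge J w c"
  by (auto simp: form_ge_def)

text \<open>Half of the double sum is the value of the quadratic form at \<open>g\<close>. Every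
  mixed term occurs twice, so halving costs no valuation even if \<open>2\<close> is not a unit; a
  termwise estimate of the double sum would lose \<open>ord 2\<close>.\<close>

lemma ge_form_half:
  fixes c :: "nat \<Rightarrow> nat \<Rightarrow> 'a"
  assumes "finite P" "form_ge P w c" "\<And>s. s \<in> P \<Longrightarrow> ge (t - w s / 2) (g s)"
  shows "ge (2 * t) ((\<Sum>r\<in>P. \<Sum>s\<in>P. g r * c r s * g s) / 2)"
  using assms
proof (induction P rule: finite_induct)
  case (insert i P)
  have sym: "(\<Sum>r\<in>P. g r * c r i * g i) = (\<Sum>s\<in>P. g i * c i s * g s)"
    using form_geD(3)[OF insert.prems(1)] by (intro sum.cong refl) (simp add: mult_ac)
  have "(\<Sum>r\<in>insert i P. \<Sum>s\<in>insert i P. g r * c r s * g s)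
    = g i * c i i * g i + (\<Sum>s\<in>P. g i * c i s * g s)
      + ((\<Sum>r\<in>P. g r * c r i * g i) + (\<Sum>r\<in>P. \<Sum>s\<in>P. g r * c r s * g s))"
    using insert.hyps by (simp add: sum.distrib)
  then have eq: "(\<Sum>r\<in>insert i P. \<Sum>s\<in>insert i P. g r * c r s * g s) / 2
    = (\<Sum>r\<in>P. \<Sum>s\<in>P. g r * c r s * g s) / 2 + (g i)\<^sup>2 * (c i i / 2) + (\<Sum>s\<in>P. g i * c i s * g s)"
    unfolding sym by (simp add: add_divide_distrib power2_eq_square)
  have "ge (2 * t) ((\<Sum>r\<in>P. \<Sum>s\<in>P. g r * c r s * g s) / 2)"
    using insert form_ge_subset by blast
  moreover have "ge (2 * t) ((g i)\<^sup>2 * (c i i / 2))"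
    by (rule ge_mult'[OF ge_power2[OF insert.prems(2)] form_geD(1)[OF insert.prems(1)]]) auto
  moreover have "ge (2 * t) (\<Sum>s\<in>P. g i * c i s * g s)"
  proof (rule ge_sum)
    fix s assume "s \<in> P"
    then have "ge (t - w i / 2 + (w i + w s) / 2) (g i * c i s)"
      using insert.prems by (intro ge_mult form_geD[OF insert.prems(1)]) auto
    then show "ge (2 * t) (g i * c i s * g s)"
      by (rule ge_mult'[where t = "t - w s / 2"]) (use \<open>s \<in> P\<close> insert.prems(2) in \<open>auto simp: field_simps\<close>)
  qed
  ultimately show ?case unfolding eq by (intro ge_add)
qed simp

section \<open>Schur complements and weights\<close>

definition schur :: "nat set \<Rightarrow> (nat \<Rightarrow> nat \<Rightarrow> 'a) \<Rightarrow> (nat \<Rightarrow> nat \<Rightarrow> 'a) \<Rightarrow> nat \<Rightarrow> nat \<Rightarrow> 'a" where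
  "schur P g c k l = c k l - (\<Sum>s\<in>P. c k s * g s l)"

text \<open>Using the linear system once more turns the correction term into a bilinear expression
  in \<open>g\<close> on the pivot block. On the diagonal this is twice a value of the quadratic
  form, which \<open>ge_form_half\<close> estimates.\<close>

lemma schur_quadratic:
  fixes c g :: "nat \<Rightarrow> nat \<Rightarrow> 'a"
  assumes "\<And>r. r \<in> P \<Longrightarrow> (\<Sum>s\<in>P. c r s * g s k) = c r k" "\<And>r. r \<in> P \<Longrightarrow> c k r = c r k"
  shows "(\<Sum>s\<in>P. c k s * g s l) = (\<Sum>r\<in>P. \<Sum>s\<in>P. g r l * c r s * g s k)"
proof -
  have "(\<Sum>s\<in>P. c k s * g s l) = (\<Sum>r\<in>P. g r l * (\<Sum>s\<in>P. c r s * g s k))"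
  proof (rule sum.cong[OF refl])
    fix r assume "r \<in> P"
    then show "c k r * g r l = g r l * (\<Sum>s\<in>P. c r s * g s k)"
      by (simp add: assms mult.commute)
  qed
  also have "\<dots> = (\<Sum>r\<in>P. \<Sum>s\<in>P. g r l * c r s * g s k)"
    by (simp add: sum_distrib_left mult.assoc)
  finally show ?thesis .
qed

text \<open>Elimination subtracts from the basis vector of index \<open>l\<close> the multiples
  \<open>g s l\<close> of those in \<open>P\<close>. The bound on \<open>g\<close> says that each
  such multiple is, relative to the weights, no worse than the vector itself, so the bounds on the
  form survive.\<close>

lemma form_ge_schur:
  assumes fin: "finite P" and form: "form_ge (P \<union> I) w c"
    and g: "\<And>r l. r \<in> P \<Longrightarrow> l \<in> I \<Longrightarrow> (\<Sum>s\<in>P. c r s * g s l) = c r l"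
    and gge: "\<And>s l. s \<in> P \<Longrightarrow> l \<in> I \<Longrightarrow> ge ((w l - w s) / 2) (g s l)"
  shows "form_ge I w (schur P g c)"
proof -
  note D = form_geD[OF form]
  have q: "(\<Sum>s\<in>P. c k s * g s l) = (\<Sum>r\<in>P. \<Sum>s\<in>P. g r l * c r s * g s k)" if "k \<in> I" for k l
    by (rule schur_quadratic) (use that D g in auto)
  have "ge (w k) (schur P g c k k / 2)" if "k \<in> I" for k
  proof -
    have "ge (2 * (w k / 2)) ((\<Sum>r\<in>P. \<Sum>s\<in>P. g r k * c r s * g s k) / 2)"
      using that gge form_ge_subset[OF form]
      by (intro ge_form_half[OF fin, where w=w]) (auto simp: diff_divide_distrib)
    moreover have "ge (w k) (c k k / 2)" using D that by auto
    ultimately show ?thesis unfolding schur_def q[OF that] diff_divide_distrib by (intro ge_diff) auto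
  qed
  moreover have "ge ((w k + w l) / 2) (schur P g c k l)" if "k \<in> I" "l \<in> I" for k l
    unfolding schur_def
  proof (rule ge_diff[OF _ ge_sum])
    show "ge ((w k + w l) / 2) (c k l)" using D that by auto
    fix s assume "s \<in> P"
    then show "ge ((w k + w l) / 2) (c k s * g s l)"
      using D[of k s] gge that by (intro ge_mult'[of "(w k + w s) / 2" _ "(w l - w s) / 2"]) (auto simp: field_simps)
  qed
  moreover have "schur P g c k l = schur P g c l k" if "k \<in> I" "l \<in> I" for k l
  proof -
    have "(\<Sum>r\<in>P. \<Sum>s\<in>P. g r l * c r s * g s k) = (\<Sum>s\<in>P. \<Sum>r\<in>P. g r l * c r s * g s k)"
      by (rule sum.swap)
    also have "\<dots> = (\<Sum>s\<in>P. \<Sum>r\<in>P. g s k * c s r * g r l)"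
      using D by (intro sum.cong refl) (auto simp: mult_ac)
    finally have "(\<Sum>s\<in>P. c k s * g s l) = (\<Sum>s\<in>P. c l s * g s k)"
      using q that by simp
    then show ?thesis using D(3)[of k l] that by (simp add: schur_def)
  qed
  ultimately show ?thesis by (auto simp: form_ge_def)
qed

lemma gdet_schur':
  assumes "finite P" "finite I" "P \<inter> I = {}"
    and "\<And>r l. r \<in> P \<Longrightarrow> l \<in> I \<Longrightarrow> (\<Sum>s\<in>P. c r s * g s l) = c r l"
  shows "gdet (P \<union> I) c = gdet P c * gdet I (schur P g c)"
  unfolding schur_def by (rule gdet_schur[OF assms])

section \<open>Elimination of unary and binary blocks\<close>

definition pair_disc :: "(nat \<Rightarrow> nat \<Rightarrow> 'a) \<Rightarrow> nat \<Rightarrow> nat \<Rightarrow> 'a" where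
  "pair_disc c i j = c i i * c j j - c i j * c j i"

text \<open>Cramer's rule for the block on \<open>i\<close>, \<open>j\<close> with column
  \<open>l\<close> as right-hand side; every \<open>s\<close> other than \<open>i\<close> is read as
  \<open>j\<close>.\<close>

definition pair_coeff :: "nat \<Rightarrow> nat \<Rightarrow> (nat \<Rightarrow> nat \<Rightarrow> 'a) \<Rightarrow> nat \<Rightarrow> nat \<Rightarrow> 'a" where
  "pair_coeff i j c s l = (if s = i then c j j * c i l - c i j * c j l
     else c i i * c j l - c j i * c i l) / pair_disc c i j"

lemma pair_coeff_solves:
  assumes "i \<noteq> j" "pair_disc c i j \<noteq> 0" "r \<in> {i, j}"
  shows "(\<Sum>s\<in>{i, j}. c r s * pair_coeff i j c s l) = c r l"
proof -
  let ?d = "pair_disc c i j"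
  have "(\<Sum>s\<in>{i, j}. c r s * pair_coeff i j c s l)
    = (c r i * (c j j * c i l - c i j * c j l) + c r j * (c i i * c j l - c j i * c i l)) / ?d"
    using assms(1) by (simp add: pair_coeff_def add_divide_distrib)
  also have "c r i * (c j j * c i l - c i j * c j l) + c r j * (c i i * c j l - c j i * c i l) = ?d * c r l"
    using assms(3) by (auto simp: pair_disc_def algebra_simps)
  finally show ?thesis using assms(2) by simp
qed

lemma ge_mult_half: "ge t (x / 2) \<Longrightarrow> ge t x"
  using ge_mult[OF ge_2, of t "x / 2"] by simp

text \<open>
  The discriminant of an integral form of even rank is a square modulo 4; in odd rank the
  determinant of its Gram matrix is even. \<open>disc_bound\<close> is a weighted version of these facts.
\<close>

definition is_disc :: "real \<Rightarrow> 'a \<Rightarrow> bool" where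
  "is_disc t d \<longleftrightarrow> (\<exists>x y. d = x\<^sup>2 + 4 * y \<and> ge (t / 2) x \<and> ge t y)"

lemma is_disc_ge: "is_disc t d \<Longrightarrow> ge t d"
  unfolding is_disc_def using ge_power2[of "t / 2"] ge_mult[OF ge_4, of t] by (auto intro!: ge_add)

lemma is_disc_mult:
  assumes "is_disc s d" "is_disc t e"
  shows "is_disc (s + t) (d * e)"
proof -
  obtain x y where x: "d = x\<^sup>2 + 4 * y" "ge (s / 2) x" "ge s y"
    using assms(1) by (auto simp: is_disc_def)
  obtain x' y' where x': "e = x'\<^sup>2 + 4 * y'" "ge (t / 2) x'" "ge t y'"
    using assms(2) by (auto simp: is_disc_def)
  have "d * e = (x * x')\<^sup>2 + 4 * (x\<^sup>2 * y' + y * e)"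
    by (simp add: x(1) x'(1) algebra_simps power2_eq_square)
  moreover have "ge ((s + t) / 2) (x * x')"
    by (rule ge_mult'[OF x(2) x'(2)]) (simp add: add_divide_distrib)
  moreover have "ge (s + t) (x\<^sup>2 * y' + y * e)"
    using ge_mult[OF ge_power2[OF x(2)] x'(3)] ge_mult[OF x(3) is_disc_ge[OF assms(2)]]
    by (intro ge_add) auto
  ultimately show ?thesis unfolding is_disc_def by blast
qed

definition disc_bound :: "nat set \<Rightarrow> real \<Rightarrow> (nat \<Rightarrow> nat \<Rightarrow> 'a) \<Rightarrow> bool" where
  "disc_bound I t c \<longleftrightarrow> (if even (card I) then is_disc t ((-1) ^ (card I div 2) * gdet I c)
     else ge t (gdet I c / 2))"

text \<open>The pivot is twice a diagonal entry of the form. From even to odd rank this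
  \<open>2\<close> is the one divided out; from odd to even rank it joins the \<open>2\<close> in
  the odd determinant to give the \<open>4\<close> of \<open>is_disc\<close>, with square part
  zero.\<close>

lemma disc_bound_single_pivot:
  assumes "finite I" "i \<notin> I" "gdet (insert i I) c = c i i * gdet I c'"
    and "disc_bound I t c'" "ge s (c i i / 2)"
  shows "disc_bound (insert i I) (s + t) c"
proof (cases "even (card I)")
  case True
  then have "ge t ((-1) ^ (card I div 2) * gdet I c')"
    using assms(4) is_disc_ge by (auto simp: disc_bound_def)
  then have "ge t (gdet I c')" by (cases "even (card I div 2)") auto
  then have "ge (s + t) (c i i / 2 * gdet I c')" by (rule ge_mult[OF assms(5)])
  then show ?thesis using True assms by (simp add: disc_bound_def)
next
  case False
  define y where "y = (-1) ^ ((card I + 1) div 2) * (c i i / 2 * (gdet I c' / 2))"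
  have "ge t (gdet I c' / 2)" using False assms(4) by (simp add: disc_bound_def)
  then have "ge (s + t) (c i i / 2 * (gdet I c' / 2))" by (rule ge_mult[OF assms(5)])
  then have "ge (s + t) y" unfolding y_def by (cases "even ((card I + 1) div 2)") auto
  moreover have "(-1) ^ ((card I + 1) div 2) * gdet (insert i I) c = 0\<^sup>2 + 4 * y"
    by (simp add: y_def assms(3))
  ultimately have "is_disc (s + t) ((-1) ^ ((card I + 1) div 2) * gdet (insert i I) c)"
    unfolding is_disc_def by (intro exI[of _ 0] exI[of _ y]) auto
  then show ?thesis using False assms(1,2) by (simp add: disc_bound_def)
qed

lemma is_disc_pair:
  assumes "form_ge {i, j} w c"
  shows "is_disc (w i + w j) (- pair_disc c i j)"
proof -
  note D = form_geD[OF assms]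
  have "- pair_disc c i j = (c i j)\<^sup>2 + 4 * - (c i i / 2 * (c j j / 2))"
    using D(3)[of i j] by (simp add: pair_disc_def power2_eq_square)
  moreover have "ge (w i + w j) (- (c i i / 2 * (c j j / 2)))"
    using ge_mult[OF D(1)[of i i] D(1)[of j j]] by simp
  ultimately show ?thesis unfolding is_disc_def using D(2)[of i j] by blast
qed

text \<open>The rank grows by two, so the sign of the discriminant flips; the flip is absorbed in
  \<open>- pair_disc\<close>, which is itself a discriminant.\<close>

lemma disc_bound_pair_pivot:
  assumes "finite I" "i \<notin> I" "j \<notin> I" "i \<noteq> j" "gdet (insert i (insert j I)) c = pair_disc c i j * gdet I c'"
    and "disc_bound I t c'" "form_ge {i, j} w c"
  shows "disc_bound (insert i (insert j I)) (w i + w j + t) c"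
proof (cases "even (card I)")
  case True
  have "(-1) ^ ((card I + 2) div 2) * gdet (insert i (insert j I)) c
    = - pair_disc c i j * ((-1) ^ (card I div 2) * gdet I c')"
    by (simp add: assms(5))
  moreover have "is_disc (w i + w j + t) \<dots>"
    using assms(6) True by (intro is_disc_mult is_disc_pair[OF assms(7)]) (auto simp: disc_bound_def)
  ultimately have "is_disc (w i + w j + t) ((-1) ^ ((card I + 2) div 2) * gdet (insert i (insert j I)) c)"
    by (rule ssubst)
  then show ?thesis using True assms(1-4) by (simp add: disc_bound_def)
next
  case False
  have "ge (w i + w j) (pair_disc c i j)" using is_disc_ge[OF is_disc_pair[OF assms(7)]] by simp
  then have "ge (w i + w j + t) (pair_disc c i j * (gdet I c' / 2))"
    using False assms(6) by (intro ge_mult) (auto simp: disc_bound_def)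
  then show ?thesis using False assms by (simp add: disc_bound_def)
qed

text \<open>
  The pivot is an entry of minimal valuation relative to the weights, taken on the diagonal if
  possible; this makes the elimination coefficients respect the weights.
\<close>

lemma minimal_entry:
  assumes "finite I" "form_ge I w c" "i0 \<in> I" "j0 \<in> I" "c i0 j0 \<noteq> 0"
  obtains \<delta> i j where "i \<in> I" "j \<in> I" "v (c i j) = ereal (\<delta> + (w i + w j) / 2)"
    "\<And>k l. k \<in> I \<Longrightarrow> l \<in> I \<Longrightarrow> ge (\<delta> + (w k + w l) / 2) (c k l)"
proof -
  define h where "h = (\<lambda>(i, j). real_of_ereal (v (c i j)) - (w i + w j) / 2)"
  define E where "E = {(i, j). i \<in> I \<and> j \<in> I \<and> c i j \<noteq> 0}"
  have fin: "finite E" unfolding E_def by (rule finite_subset[of _ "I \<times> I"]) (use assms(1) in auto)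
  have ne: "E \<noteq> {}" using assms unfolding E_def by auto
  obtain i j where ij: "(i, j) \<in> E" "\<And>p. p \<in> E \<Longrightarrow> h (i, j) \<le> h p"
    using ex_is_arg_min_if_finite[OF fin ne, of h] unfolding is_arg_min_linorder by (metis surj_pair)
  have vr: "v x = ereal (real_of_ereal (v x))" if "x \<noteq> 0" for x
    using that by (metis v_nonzero_int real_of_ereal.simps(1))
  show ?thesis
  proof (rule that[of i j "h (i, j)"])
    show "i \<in> I" "j \<in> I" using ij(1) by (auto simp: E_def)
    have "c i j \<noteq> 0" using ij(1) by (auto simp: E_def)
    then show "v (c i j) = ereal (h (i, j) + (w i + w j) / 2)" using vr[of "c i j"] by (simp add: h_def)
    fix k l assume kl: "k \<in> I" "l \<in> I"
    show "ge (h (i, j) + (w k + w l) / 2) (c k l)"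
    proof (cases "c k l = 0")
      case False
      then have "h (i, j) \<le> h (k, l)" using kl by (intro ij(2)) (auto simp: E_def)
      then have "h (i, j) + (w k + w l) / 2 \<le> real_of_ereal (v (c k l))" by (simp add: h_def)
      then show ?thesis using vr[OF False] unfolding ge_def by (metis ereal_less_eq(3))
    qed simp
  qed
qed

text \<open>Elimination by pivot blocks of size one or two. Size two is unavoidable, as no diagonal
  entry need attain the minimal excess \<open>\<delta>\<close> over the weights.\<close>

lemma form_ge_disc_bound:
  assumes "finite I" "form_ge I w c"
  shows "disc_bound I (sum w I) c"
  using assms
proof (induction "card I" arbitrary: I c rule: less_induct)
  case less
  note fin = less.prems(1) and D = form_geD[OF less.prems(2)]
  consider "I = {}" | "I \<noteq> {}" "\<forall>i\<in>I. \<forall>j\<in>I. c i j = 0" | i0 j0 where "i0 \<in> I" "j0 \<in> I" "c i0 j0 \<noteq> 0" by blast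
  then show ?case
  proof cases
    case 1
    have "is_disc 0 1" unfolding is_disc_def by (rule exI[of _ 1], rule exI[of _ 0]) auto
    with 1 show ?thesis by (simp add: disc_bound_def)
  next
    case 2
    then have "gdet I c = 0" using fin by (intro gdet_zero) auto
    then show ?thesis by (auto simp: disc_bound_def is_disc_def intro!: exI[of _ 0])
  next
    case 3
    from minimal_entry[OF less.prems 3] obtain \<delta> i0 j0 where
      ij0: "i0 \<in> I" "j0 \<in> I" "v (c i0 j0) = ereal (\<delta> + (w i0 + w j0) / 2)"
      and min: "\<And>k l. k \<in> I \<Longrightarrow> l \<in> I \<Longrightarrow> ge (\<delta> + (w k + w l) / 2) (c k l)" by metis
    show ?thesis
    proof (cases "\<exists>i\<in>I. v (c i i) = ereal (\<delta> + w i)")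
      case True
      then obtain i where i: "i \<in> I" "v (c i i) = ereal (\<delta> + w i)" by blast
      define J g where "J = I - {i}" and "g = (\<lambda>s l. c s l / c i i)"
      have I: "I = {i} \<union> J" "i \<notin> J" "finite J" using i fin by (auto simp: J_def)
      have g: "(\<Sum>s\<in>{i}. c r s * g s l) = c r l" if "r \<in> {i}" for r l
        using that v_eq_real_imp_nonzero[OF i(2)] by (simp add: g_def)
      have gge: "ge ((w l - w s) / 2) (g s l)" if "s \<in> {i}" "l \<in> J" for s l
      proof -
        have "ge (\<delta> + (w i + w l) / 2 - (\<delta> + w i)) (c i l / c i i)"
          using that I i by (intro ge_divide[OF min]) auto
        then show ?thesis using that by (simp add: g_def field_simps)
      qed
      have "form_ge J w (schur {i} g c)"
        using less.prems(2) I g gge by (intro form_ge_schur) auto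
      moreover have "card J < card I" using I fin by simp
      ultimately have "disc_bound J (sum w J) (schur {i} g c)" using less.hyps I by blast
      moreover have "gdet (insert i J) c = c i i * gdet J (schur {i} g c)"
        using gdet_schur'[of "{i}" J c g] g I by auto
      ultimately have "disc_bound (insert i J) (w i + sum w J) c"
        using D(1)[OF i(1) i(1)] I by (intro disc_bound_single_pivot) auto
      then show ?thesis using I by simp
    next
      case False
      define i j where "i = i0" and "j = j0"
      note ij = ij0[folded i_def j_def]
      have "i \<noteq> j" using False ij by auto
      define J g where "J = I - {i, j}" and "g = pair_coeff i j c"
      have I: "I = {i, j} \<union> J" "i \<notin> J" "j \<notin> J" "finite J" using ij fin by (auto simp: J_def)
      \<comment> \<open>No diagonal entry attains the minimal excess, so
        \<open>c i j * c j i\<close> dominates \<open>c i i * c j j\<close> and fixes the valuation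
        of the block determinant.\<close>
      have "gt (\<delta> + w k) (c k k)" if "k \<in> I" for k
        using min[OF that that] False that by (simp add: ge_iff_gt_or)
      then have "gt (\<delta> + w i + (\<delta> + w j)) (c i i * c j j)"
        using ij by (intro gt_mult gt_imp_ge) auto
      moreover have "v (c i j * c j i) = ereal (\<delta> + w i + (\<delta> + w j))"
        using v_mult_real[OF ij(3) ij(3)] D(3)[OF ij(1,2)] by (simp add: field_simps)
      ultimately have "v (- (c i j * c j i) + c i i * c j j) = ereal (\<delta> + w i + (\<delta> + w j))"
        by (intro v_add_gt) auto
      then have vd: "v (pair_disc c i j) = ereal (2 * \<delta> + w i + w j)"
        by (simp add: pair_disc_def algebra_simps)
      have g: "(\<Sum>s\<in>{i, j}. c r s * g s l) = c r l" if "r \<in> {i, j}" for r l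
        unfolding g_def using that \<open>i \<noteq> j\<close> v_eq_real_imp_nonzero[OF vd] by (intro pair_coeff_solves)
      \<comment> \<open>One estimate serves both Cramer numerators: \<open>k\<close> is the index of
        the coefficient, \<open>m\<close> the other index of the block. The excess
        \<open>2 * \<delta>\<close> cancels against that of the determinant.\<close>
      have gcoeff: "ge ((w l - w k) / 2) ((c m m * c k l - c k m * c m l) / pair_disc c i j)"
        if "l \<in> I" "k \<in> I" "m \<in> I" "w k + w m = w i + w j" for k l m
      proof -
        have "ge (2 * \<delta> + (w k + w l) / 2 + w m) (c m m * c k l - c k m * c m l)"
          using that by (intro ge_diff ge_mult'[OF min min]) (auto simp: field_simps)
        then show ?thesis using that by (intro ge_mono[OF ge_divide[OF _ vd]]) (auto simp: field_simps)
      qed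
      have gge: "ge ((w l - w s) / 2) (g s l)" if "s \<in> {i, j}" "l \<in> J" for s l
      proof -
        have "l \<in> I" using that I by auto
        then show ?thesis using that ij(1,2) \<open>i \<noteq> j\<close>
          by (auto simp: g_def pair_coeff_def intro!: gcoeff)
      qed
      have "form_ge J w (schur {i, j} g c)"
        using less.prems(2) I g gge by (intro form_ge_schur) auto
      moreover have "card J < card I" using I fin ij by (auto intro: psubset_card_mono)
      ultimately have "disc_bound J (sum w J) (schur {i, j} g c)" using less.hyps I by blast
      moreover have "gdet (insert i (insert j J)) c = pair_disc c i j * gdet J (schur {i, j} g c)"
        using gdet_schur'[of "{i, j}" J c g] g I gdet_pair[OF \<open>i \<noteq> j\<close>, of c] by (auto simp: pair_disc_def)
      moreover have "form_ge {i, j} w c" using less.prems(2) I by (blast intro: form_ge_subset)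
      ultimately have "disc_bound (insert i (insert j J)) (w i + w j + sum w J) c"
        using \<open>i \<noteq> j\<close> I by (intro disc_bound_pair_pivot) auto
      then show ?thesis using I \<open>i \<noteq> j\<close> by (simp add: add.assoc)
    qed
  qed
qed

end

section \<open>Forms with nonsingular residual form\<close>

context nonarch_local_field
begin

lemma gt_imp_ge_plus:
  assumes "gt t x"
  obtains \<epsilon> where "\<epsilon> > 0" "ge (t + \<epsilon>) x"
proof (cases "x = 0")
  case True
  then show ?thesis using that[of 1] by simp
next
  case False
  then obtain m :: int where "v x = ereal (real_of_int m)" by (rule v_nonzero_int)
  then show ?thesis using assms that[of "real_of_int m - t"] by (simp add: gt_def ge_def)
qed

text \<open>Finitely many strict bounds hold with a common margin. With this margin the non-strict
  \<open>ge_form_half\<close> also yields strict estimates.\<close>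

lemma gt_imp_ge_plus_uniform:
  assumes "finite P" "\<And>s. s \<in> P \<Longrightarrow> gt (t s) (x s)"
  shows "\<exists>\<epsilon>>0. \<forall>s\<in>P. ge (t s + \<epsilon>) (x s)"
  using assms
proof (induction P rule: finite_induct)
  case (insert s P)
  obtain \<epsilon> where e: "\<epsilon> > 0" "\<forall>s\<in>P. ge (t s + \<epsilon>) (x s)" using insert by auto
  obtain \<eta> where h: "\<eta> > 0" "ge (t s + \<eta>) (x s)" using insert.prems gt_imp_ge_plus[of "t s" "x s"] by auto
  show ?case
    using e h by (intro exI[of _ "min \<epsilon> \<eta>"]) (auto intro: ge_mono)
qed (auto intro: exI[of _ 1])

lemma gt_sum: "(\<And>i. i \<in> A \<Longrightarrow> gt t (f i)) \<Longrightarrow> gt t (sum f A)"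
  by (induction A rule: infinite_finite_induct) (auto intro: gt_add)

text \<open>If the coefficients exceed their bounds strictly, elimination alters the remaining form
  only by terms above the weights, so its residual form stays the same.\<close>

lemma schur_strict:
  assumes fin: "finite P" and form: "form_ge (P \<union> I) w c"
    and g: "\<And>r l. r \<in> P \<Longrightarrow> l \<in> I \<Longrightarrow> (\<Sum>s\<in>P. c r s * g s l) = c r l"
    and ggt: "\<And>s l. s \<in> P \<Longrightarrow> l \<in> I \<Longrightarrow> gt ((w l - w s) / 2) (g s l)"
    and k: "k \<in> I"
  shows "gt (w k) ((c k k - schur P g c k k) / 2)"
    and "l \<in> I \<Longrightarrow> gt ((w k + w l) / 2) (c k l - schur P g c k l)"
proof -
  note D = form_geD[OF form]
  obtain \<epsilon> where e: "\<epsilon> > 0" "\<And>s. s \<in> P \<Longrightarrow> ge ((w k - w s) / 2 + \<epsilon>) (g s k)"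
    using gt_imp_ge_plus_uniform[OF fin, of "\<lambda>s. (w k - w s) / 2" "\<lambda>s. g s k"] ggt k by auto
  have "ge (2 * (w k / 2 + \<epsilon>)) ((\<Sum>r\<in>P. \<Sum>s\<in>P. g r k * c r s * g s k) / 2)"
    using form_ge_subset[OF form] e(2)
    by (intro ge_form_half[OF fin, where w=w]) (auto simp: diff_divide_distrib algebra_simps)
  moreover have "(\<Sum>s\<in>P. c k s * g s k) = (\<Sum>r\<in>P. \<Sum>s\<in>P. g r k * c r s * g s k)"
    by (rule schur_quadratic) (use k D g in auto)
  ultimately have "ge (w k + 2 * \<epsilon>) ((c k k - schur P g c k k) / 2)" by (simp add: schur_def)
  then show "gt (w k) ((c k k - schur P g c k k) / 2)" by (rule ge_imp_gt) (use e(1) in simp)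
  assume l: "l \<in> I"
  have "gt ((w k + w l) / 2) (c k s * g s l)" if "s \<in> P" for s
    using D(2)[of k s] ggt[of s l] k l that
    by (intro gt_mult'[of "(w k + w s) / 2" _ "(w l - w s) / 2"]) (auto simp: field_simps)
  then show "gt ((w k + w l) / 2) (c k l - schur P g c k l)"
    by (auto simp: schur_def intro!: gt_sum)
qed

text \<open>The two determinants differ by a sum of products in each of which one factor lies
  strictly above its weight, so whether the weight is attained depends on the residual form
  only.\<close>

lemma pair_disc_perturb:
  assumes "v (pair_disc c k l) = ereal (w k + w l)"
    and c: "ge (w k) (c k k)" "ge (w l) (c l l)" "ge ((w k + w l) / 2) (c k l)" "ge ((w k + w l) / 2) (c l k)"
    and d: "gt (w k) (c k k - d k k)" "gt (w l) (c l l - d l l)"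
      "gt ((w k + w l) / 2) (c k l - d k l)" "gt ((w k + w l) / 2) (c l k - d l k)"
  shows "v (pair_disc d k l) = ereal (w k + w l)"
proof -
  have dkk: "ge (w k) (d k k)" using ge_diff[OF c(1) gt_imp_ge[OF d(1)]] by simp
  have dkl: "ge ((w k + w l) / 2) (d k l)" using ge_diff[OF c(3) gt_imp_ge[OF d(3)]] by simp
  have "gt (w k + w l) (c l l * (c k k - d k k))" "gt (w k + w l) (d k k * (c l l - d l l))"
    "gt (w k + w l) (c l k * (c k l - d k l))" "gt (w k + w l) (d k l * (c l k - d l k))"
    by (rule gt_mult'[OF c(2) d(1)], simp, rule gt_mult'[OF dkk d(2)], simp,
      rule gt_mult'[OF c(4) d(3)], simp, rule gt_mult'[OF dkl d(4)], simp)
  then have "gt (w k + w l) (c l k * (c k l - d k l) + d k l * (c l k - d l k)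
      - (c l l * (c k k - d k k) + d k k * (c l l - d l l)))"
    by (intro gt_diff gt_add)
  moreover have "pair_disc d k l = pair_disc c k l + (c l k * (c k l - d k l) + d k l * (c l k - d l k)
      - (c l l * (c k k - d k k) + d k k * (c l l - d l l)))"
    by (simp add: pair_disc_def algebra_simps)
  ultimately show ?thesis using v_add_gt[OF assms(1)] by simp
qed

text \<open>
  The residual quadratic form of \<open>c\<close> relative to the weights \<open>w\<close> is an orthogonal sum of
  nonsingular binary forms, indexed by the 2-cycles of \<open>\<tau>\<close>, and of nonzero unary forms.
\<close>

definition split_form :: "nat set \<Rightarrow> (nat \<Rightarrow> real) \<Rightarrow> (nat \<Rightarrow> nat) \<Rightarrow> (nat \<Rightarrow> nat \<Rightarrow> 'a) \<Rightarrow> bool" where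
  "split_form I w \<tau> c \<longleftrightarrow> form_ge I w c \<and> (\<forall>i\<in>I. \<tau> i \<in> I \<and> \<tau> (\<tau> i) = i) \<and>
    (\<forall>i\<in>I. \<tau> i = i \<longrightarrow> v (c i i / 2) = ereal (w i)) \<and>
    (\<forall>i\<in>I. \<tau> i \<noteq> i \<longrightarrow> v (pair_disc c i (\<tau> i)) = ereal (w i + w (\<tau> i))) \<and>
    (\<forall>i\<in>I. \<forall>j\<in>I. j \<noteq> i \<longrightarrow> j \<noteq> \<tau> i \<longrightarrow> gt ((w i + w j) / 2) (c i j))"

text \<open>The block determinant attains its weight and the entries linking the block to the rest
  are strictly above theirs. The elimination coefficients are then strict too, and the rest keeps
  its residual form.\<close>

lemma split_form_schur:
  assumes fin: "finite I" and split: "split_form I w \<tau> c" and i: "i \<in> I" "\<tau> i \<noteq> i"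
  obtains d where "split_form (I - {i, \<tau> i}) w \<tau> d"
    "gdet I c = pair_disc c i (\<tau> i) * gdet (I - {i, \<tau> i}) d"
proof -
  define j J g where "j = \<tau> i" and "J = I - {i, j}" and "g = pair_coeff i j c"
  have form: "form_ge I w c" using split by (simp add: split_form_def)
  note D = form_geD[OF form]
  have inv: "\<tau> k \<in> I" "\<tau> (\<tau> k) = k" if "k \<in> I" for k using split that by (auto simp: split_form_def)
  have ij: "i \<noteq> j" "j \<in> I" "\<tau> j = i" using i inv by (auto simp: j_def)
  have I: "I = {i, j} \<union> J" "{i, j} \<inter> J = {}" "finite J" using i ij fin by (auto simp: J_def)
  have invJ: "\<tau> k \<in> J" if "k \<in> J" for k
  proof -
    have "k \<in> I" "k \<noteq> i" "k \<noteq> j" using that by (auto simp: J_def)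
    then have "\<tau> k \<in> I" "\<tau> k \<noteq> i" "\<tau> k \<noteq> j" using inv[of k] ij(3) by (auto simp: j_def)
    then show ?thesis by (simp add: J_def)
  qed
  have vd: "v (pair_disc c i j) = ereal (w i + w j)" using split i by (auto simp: split_form_def j_def)
  have strict: "gt ((w k + w l) / 2) (c k l)" if "k \<in> {i, j}" "l \<in> J" for k l
    using split that i ij by (auto simp: split_form_def J_def j_def)
  have diag: "ge (w k) (c k k)" if "k \<in> I" for k using D(1)[OF that that] by (rule ge_mult_half)
  have g: "(\<Sum>s\<in>{i, j}. c r s * g s l) = c r l" if "r \<in> {i, j}" for r l
    unfolding g_def using that ij(1) v_eq_real_imp_nonzero[OF vd] by (intro pair_coeff_solves)
  have gcoeff: "gt ((w l - w k) / 2) ((c m m * c k l - c k m * c m l) / pair_disc c i j)"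
    if "l \<in> J" "k \<in> {i, j}" "m \<in> {i, j}" "w k + w m = w i + w j" for k l m
  proof -
    have "m \<in> I" "k \<in> I" using that I by auto
    then have "gt ((w k + w l) / 2 + w m) (c m m * c k l)" "gt ((w k + w l) / 2 + w m) (c k m * c m l)"
      using gt_mult'[OF diag strict, of m k l] gt_mult'[OF D(2) strict, of k m m l] that
      by (auto simp: field_simps)
    then have "gt ((w k + w l) / 2 + w m) (c m m * c k l - c k m * c m l)" by (rule gt_diff)
    then show ?thesis using that(4) by (intro gt_mono[OF gt_divide[OF _ vd]]) (auto simp: field_simps)
  qed
  have ggt: "gt ((w l - w s) / 2) (g s l)" if "s \<in> {i, j}" "l \<in> J" for s l
    using that ij(1) by (auto simp: g_def pair_coeff_def intro!: gcoeff)
  define d where "d = schur {i, j} g c"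
  have fd: "form_ge J w d"
    unfolding d_def using form I g gt_imp_ge[OF ggt] by (intro form_ge_schur) auto
  have off: "gt ((w k + w l) / 2) (c k l - d k l)" if "k \<in> J" "l \<in> J" for k l
    unfolding d_def using form I g ggt that by (intro schur_strict(2)[of _ J]) auto
  have half: "gt (w k) ((c k k - d k k) / 2)" if "k \<in> J" for k
    unfolding d_def using form I g ggt that by (intro schur_strict(1)[of _ J]) auto
  have "v (d k k / 2) = ereal (w k)" if k: "k \<in> J" "\<tau> k = k" for k
  proof -
    have "v (c k k / 2) = ereal (w k)" using split k I by (auto simp: split_form_def)
    then have "v (c k k / 2 + - ((c k k - d k k) / 2)) = ereal (w k)"
      using half[OF k(1)] by (intro v_add_gt) auto
    then show ?thesis by (simp add: diff_divide_distrib)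
  qed
  moreover have "v (pair_disc d k (\<tau> k)) = ereal (w k + w (\<tau> k))" if k: "k \<in> J" "\<tau> k \<noteq> k" for k
  proof (rule pair_disc_perturb)
    have l: "\<tau> k \<in> J" "k \<in> I" "\<tau> k \<in> I" using invJ k I by auto
    show "v (pair_disc c k (\<tau> k)) = ereal (w k + w (\<tau> k))" using split k l by (auto simp: split_form_def)
    show "ge (w k) (c k k)" "ge (w (\<tau> k)) (c (\<tau> k) (\<tau> k))" using diag l by auto
    show "ge ((w k + w (\<tau> k)) / 2) (c k (\<tau> k))" "ge ((w k + w (\<tau> k)) / 2) (c (\<tau> k) k)"
      using D(2)[of k "\<tau> k"] D(2)[of "\<tau> k" k] l by (auto simp: add.commute)
    show "gt (w k) (c k k - d k k)" "gt (w (\<tau> k)) (c (\<tau> k) (\<tau> k) - d (\<tau> k) (\<tau> k))"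
      "gt ((w k + w (\<tau> k)) / 2) (c k (\<tau> k) - d k (\<tau> k))" "gt ((w k + w (\<tau> k)) / 2) (c (\<tau> k) k - d (\<tau> k) k)"
      using off[of k k] off[of "\<tau> k" "\<tau> k"] off[of k "\<tau> k"] off[of "\<tau> k" k] l k by (auto simp: add.commute)
  qed
  moreover have "gt ((w k + w l) / 2) (d k l)" if "k \<in> J" "l \<in> J" "l \<noteq> k" "l \<noteq> \<tau> k" for k l
  proof -
    have "gt ((w k + w l) / 2) (c k l)" using split that I by (auto simp: split_form_def)
    from gt_diff[OF this off[OF that(1,2)]] show ?thesis by simp
  qed
  ultimately have "split_form J w \<tau> d"
    using fd inv invJ I by (auto simp: split_form_def)
  moreover have "gdet I c = pair_disc c i j * gdet J d"
    using gdet_schur'[of "{i, j}" J c g] g I gdet_pair[OF ij(1), of c] by (auto simp: pair_disc_def d_def)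
  ultimately show ?thesis using that by (simp add: J_def j_def)
qed

text \<open>The shape produced by two unary summands, where \<open>y\<close> is minus the product of
  the two diagonal entries. If \<open>2\<close> is not a unit, \<open>x\<^sup>2\<close> and
  \<open>4 * y\<close> can have any relative size, so the valuation of \<open>d\<close> itself is
  not determined.\<close>

definition exact_disc :: "real \<Rightarrow> 'a \<Rightarrow> bool" where
  "exact_disc t d \<longleftrightarrow> (\<exists>x y. d = x\<^sup>2 + 4 * y \<and> gt (t / 2) x \<and> v y = ereal t)"

text \<open>The product is grouped so that the new \<open>y\<close> has the leading part
  \<open>d * y'\<close> of exact valuation; the remaining part carries \<open>x'\<^sup>2\<close> and
  lies strictly above.\<close>

lemma exact_disc_mult:
  assumes "is_disc s d" "v d = ereal s" "exact_disc t e"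
  shows "exact_disc (s + t) (d * e)"
proof -
  obtain x y where x: "d = x\<^sup>2 + 4 * y" "ge (s / 2) x" "ge s y"
    using assms(1) by (auto simp: is_disc_def)
  obtain x' y' where x': "e = x'\<^sup>2 + 4 * y'" "gt (t / 2) x'" "v y' = ereal t"
    using assms(3) by (auto simp: exact_disc_def)
  have "d * e = (x * x')\<^sup>2 + 4 * (d * y' + y * x'\<^sup>2)"
    by (simp add: x(1) x'(1) algebra_simps power2_eq_square)
  moreover have "gt ((s + t) / 2) (x * x')"
    by (rule gt_mult'[OF x(2) x'(2)]) (simp add: add_divide_distrib)
  moreover have "v (d * y' + y * x'\<^sup>2) = ereal (s + t)"
    using gt_mult[OF x(3) gt_power2[OF x'(2)]] by (intro v_add_gt v_mult_real assms(2) x'(3)) simp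
  ultimately show ?thesis unfolding exact_disc_def by blast
qed

text \<open>\<open>z\<close> counts the unary summands. With none or one, the lower bound of
  \<open>disc_bound\<close> is attained; with two, only the shape of the discriminant is
  recorded.\<close>

definition split_disc :: "nat set \<Rightarrow> real \<Rightarrow> nat \<Rightarrow> (nat \<Rightarrow> nat \<Rightarrow> 'a) \<Rightarrow> bool" where
  "split_disc I t z c \<longleftrightarrow> even (card I + z) \<and> (z = 0 \<longrightarrow> v (gdet I c) = ereal t) \<and>
    (z = 1 \<longrightarrow> v (gdet I c / 2) = ereal t) \<and>
    (z = 2 \<longrightarrow> exact_disc t ((-1) ^ (card I div 2) * gdet I c))"

text \<open>The 2-cycles are eliminated one at a time, each contributing a factor of exact
  valuation. The unary summands left over are explicit up to rank two.\<close>

lemma split_form_disc: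
  assumes "finite I" "split_form I w \<tau> c"
  shows "split_disc I (sum w I) (card {i \<in> I. \<tau> i = i}) c"
  using assms
proof (induction "card I" arbitrary: I c rule: less_induct)
  case less
  note fin = less.prems(1) and split = less.prems(2)
  have form: "form_ge I w c" using split by (simp add: split_form_def)
  show ?case
  proof (cases "\<exists>i\<in>I. \<tau> i \<noteq> i")
    case True
    then obtain i where i: "i \<in> I" "\<tau> i \<noteq> i" by blast
    define j J where "j = \<tau> i" and "J = I - {i, j}"
    obtain d where d: "split_form J w \<tau> d" "gdet I c = pair_disc c i j * gdet J d"
      using split_form_schur[OF fin split i] by (auto simp: j_def J_def)
    have j: "j \<in> I" "\<tau> j = i" "i \<noteq> j" using split i by (auto simp: split_form_def j_def)
    have I: "I = insert i (insert j J)" "i \<notin> J" "j \<notin> J" "finite J" using i j fin by (auto simp: J_def)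
    have card: "card I = card J + 2" using I j by simp
    have Z: "{k \<in> I. \<tau> k = k} = {k \<in> J. \<tau> k = k}" using I i j by auto
    have S: "sum w I = (w i + w j) + sum w J" using I j by simp
    have vd: "v (- pair_disc c i j) = ereal (w i + w j)" using split i by (auto simp: split_form_def j_def)
    have dd: "is_disc (w i + w j) (- pair_disc c i j)"
      by (rule is_disc_pair) (use form I in \<open>auto intro: form_ge_subset\<close>)
    have IH: "split_disc J (sum w J) (card {k \<in> J. \<tau> k = k}) d"
      using less.hyps[of J d] card I d by simp
    have "exact_disc (sum w I) ((-1) ^ (card I div 2) * gdet I c)"
      if "exact_disc (sum w J) ((-1) ^ (card J div 2) * gdet J d)"
    proof -
      have eq: "(-1) ^ (card I div 2) * gdet I c = - pair_disc c i j * ((-1) ^ (card J div 2) * gdet J d)"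
        by (simp add: card d(2))
      show ?thesis unfolding S eq by (rule exact_disc_mult[OF dd vd that])
    qed
    moreover have "v (gdet I c) = ereal (sum w I)" if "v (gdet J d) = ereal (sum w J)"
      unfolding S d(2) by (rule v_mult_real[OF vd[unfolded v_minus] that])
    moreover have "v (gdet I c / 2) = ereal (sum w I)" if "v (gdet J d / 2) = ereal (sum w J)"
      using v_mult_real[OF vd[unfolded v_minus] that] unfolding S d(2) by simp
    ultimately show ?thesis using IH unfolding split_disc_def Z card by simp
  next
    case False
    then have Z: "{i \<in> I. \<tau> i = i} = I" by auto
    have diag: "v (c i i / 2) = ereal (w i)" if "i \<in> I" for i
      using split False that by (auto simp: split_form_def)
    have "v (gdet I c) = ereal (sum w I)" if "card I = 0"
      using that fin by (simp add: zero_ereal_def)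
    moreover have "v (gdet I c / 2) = ereal (sum w I)" if "card I = 1"
      using that diag by (auto simp: card_1_singleton_iff)
    moreover have "exact_disc (sum w I) ((-1) ^ (card I div 2) * gdet I c)" if "card I = 2"
    proof -
      obtain i j where ij: "I = {i, j}" "i \<noteq> j" using \<open>card I = 2\<close> unfolding card_2_iff by blast
      have "gt ((w i + w j) / 2) (c i j)" using split False ij by (auto simp: split_form_def)
      moreover have "v (- (c i i / 2 * (c j j / 2))) = ereal (w i + w j)"
        using v_mult_real[OF diag[of i] diag[of j]] ij by simp
      moreover have "- gdet I c = (c i j)\<^sup>2 + 4 * - (c i i / 2 * (c j j / 2))"
        using form_geD(3)[OF form, of i j] ij by (simp add: gdet_pair power2_eq_square)
      ultimately have "exact_disc (w i + w j) (- gdet I c)" unfolding exact_disc_def by blast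
      then show ?thesis using ij by simp
    qed
    ultimately show ?thesis unfolding Z split_disc_def by simp
  qed
qed

text \<open>
  With \<open>z\<close> the difference of the two square roots, \<open>z (z + 2 X)\<close> has odd valuation, which forces
  \<open>z\<close> and \<open>z + 2 X\<close> to have different valuations and so bounds that of \<open>2 X\<close> from above.
\<close>

lemma exact_disc_bound:
  assumes "exact_disc t d" "is_disc s (e\<^sup>2 * d)" "v e = 0" "t = 2 * real_of_int m + 1"
  shows "s < t + 1"
proof (rule ccontr)
  assume "\<not> s < t + 1"
  then have st: "t + 1 \<le> s" by simp
  obtain x y where x: "d = x\<^sup>2 + 4 * y" "v y = ereal t" using assms(1) by (auto simp: exact_disc_def)
  obtain X Y where X: "e\<^sup>2 * d = X\<^sup>2 + 4 * Y" "ge (s / 2) X" "ge s Y" using assms(2) by (auto simp: is_disc_def)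
  obtain k2 :: int where k2: "v 2 = ereal (real_of_int k2)" by (rule v_2)
  define z where "z = e * x - X"
  have z: "z * (z + 2 * X) = 4 * (- (e\<^sup>2 * y) + Y)"
    using X(1) by (simp add: z_def x(1) algebra_simps power2_eq_square)
  have "v (- (e\<^sup>2 * y) + Y) = ereal t"
  proof (rule v_add_gt)
    show "v (- (e\<^sup>2 * y)) = ereal t" by (simp add: v_mult power2_eq_square assms(3) x(2))
    show "gt t Y" using X(3) by (rule ge_imp_gt) (use st in simp)
  qed
  moreover have "v 4 = ereal (2 * real_of_int k2)"
    using v_mult_real[OF k2 k2] by simp
  ultimately have vp: "v (z * (z + 2 * X)) = ereal (2 * real_of_int k2 + t)"
    unfolding z using v_mult_real by blast
  then have "z \<noteq> 0" using v_zero by auto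
  then obtain k :: int where k: "v z = ereal (real_of_int k)" by (rule v_nonzero_int)
  have X2: "ge (real_of_int k2 + real_of_int m + 1) (2 * X)"
    using st assms(4) by (intro ge_mult'[OF ge_eq[OF k2] X(2)]) simp
  show False
  \<comment> \<open>The threshold is the least integer above half of \<open>2 * k2 + t\<close>, the
    valuation of the product.\<close>
  proof (cases "k \<ge> k2 + m + 1")
    case True
    then have z: "ge (real_of_int k2 + real_of_int m + 1) z" by (simp add: ge_def k)
    have "ge (2 * real_of_int k2 + t + 1) (z * (z + 2 * X))"
      by (rule ge_mult'[OF z ge_add[OF z X2]]) (simp add: assms(4))
    then show False by (simp add: ge_def vp)
  next
    case False
    then have "real_of_int k < real_of_int k2 + real_of_int m + 1" by linarith
    then have "v (z + 2 * X) = ereal (real_of_int k)" by (intro v_add_gt[OF k] ge_imp_gt[OF X2])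
    then have "2 * real_of_int k = 2 * real_of_int k2 + (2 * real_of_int m + 1)" using vp k by (simp add: v_mult assms(4))
    then have "2 * k = 2 * k2 + (2 * m + 1)" by linarith
    then show False by presburger
  qed
qed

text \<open>With at most one unary summand, the attained valuation is compared directly with the
  lower bound for \<open>d\<close>. With two, \<open>exact_disc_bound\<close> is the source of the
  \<open>+ 1\<close>, which integral weights turn into \<open>\<le>\<close>.\<close>

lemma split_form_maximal:
  assumes fin: "finite I" and split: "split_form I w \<tau> c" and form: "form_ge I b d"
    and det: "gdet I d = e\<^sup>2 * gdet I c" "v e = 0"
    and Z: "card {i \<in> I. \<tau> i = i} \<le> 2"
    and odd: "card {i \<in> I. \<tau> i = i} = 2 \<Longrightarrow> \<exists>m::int. sum w I = 2 * real_of_int m + 1"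
  shows "sum b I < sum w I + 1"
proof -
  let ?z = "card {i \<in> I. \<tau> i = i}"
  have sd: "split_disc I (sum w I) ?z c" by (rule split_form_disc[OF fin split])
  have db: "disc_bound I (sum b I) d" by (rule form_ge_disc_bound[OF fin form])
  have ve: "v (e\<^sup>2) = ereal 0" using det(2) by (simp add: power2_eq_square v_mult zero_ereal_def)
  consider "?z = 0" | "?z = 1" | "?z = 2" using Z by linarith
  then show ?thesis
  proof cases
    case 1
    then have "even (card I)" "v (gdet I d) = ereal (sum w I)"
      using sd v_mult_real[OF ve] by (auto simp: split_disc_def det(1))
    moreover from this have "ge (sum b I) ((-1) ^ (card I div 2) * gdet I d)"
      using db by (simp add: disc_bound_def is_disc_ge)
    then have "ge (sum b I) (gdet I d)" by (cases "even (card I div 2)") simp_all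
    ultimately show ?thesis by (simp add: ge_def)
  next
    case 2
    then have "odd (card I)" "v (gdet I d / 2) = ereal (sum w I)"
      using sd v_mult_real[OF ve, of "gdet I c / 2"] by (auto simp: split_disc_def det(1))
    then show ?thesis using db by (auto simp: disc_bound_def ge_def)
  next
    case 3
    then have "even (card I)" "exact_disc (sum w I) ((-1) ^ (card I div 2) * gdet I c)"
      using sd by (auto simp: split_disc_def)
    moreover have "is_disc (sum b I) (e\<^sup>2 * ((-1) ^ (card I div 2) * gdet I c))"
      using db \<open>even (card I)\<close> by (simp add: disc_bound_def det(1) mult.left_commute)
    ultimately show ?thesis using exact_disc_bound[OF _ _ det(2)] odd[OF 3] by blast
  qed
qed

lemma split_form_nonzero:
  assumes fin: "finite I" and split: "split_form I w \<tau> c"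
    and Z: "card {i \<in> I. \<tau> i = i} \<le> 2"
    and odd: "card {i \<in> I. \<tau> i = i} = 2 \<Longrightarrow> \<exists>m::int. sum w I = 2 * real_of_int m + 1"
  shows "gdet I c \<noteq> 0"
proof
  assume 0: "gdet I c = 0"
  let ?z = "card {i \<in> I. \<tau> i = i}"
  have sd: "split_disc I (sum w I) ?z c" by (rule split_form_disc[OF fin split])
  consider "?z = 0" | "?z = 1" | "?z = 2" using Z by linarith
  then show False
  proof cases
    case 3
    then obtain m :: int where m: "sum w I = 2 * real_of_int m + 1" using odd by blast
    \<comment> \<open>Zero is a discriminant for every weight, in particular for one that
      \<open>exact_disc_bound\<close> excludes.\<close>
    have "is_disc (sum w I + 1) (1\<^sup>2 * 0)" unfolding is_disc_def by (intro exI[of _ 0]) simp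
    with 3 sd 0 m exact_disc_bound[of "sum w I" 0 "sum w I + 1" 1] show False
      by (auto simp: split_disc_def)
  qed (use sd 0 v_zero in \<open>auto simp: split_disc_def\<close>)
qed

end

section \<open>Candidates for the Gross--Keating invariant\<close>

lemma lexordp_eq_finite_max:
  assumes "finite T" "T \<noteq> {}"
  shows "\<exists>a\<in>T. \<forall>b\<in>T. lexordp_eq b (a :: int list)"
  using assms
proof (induction T rule: finite_ne_induct)
  case (insert x T)
  then obtain a where a: "a \<in> T" "\<forall>b\<in>T. lexordp_eq b a" by blast
  show ?case
  proof (cases "lexordp_eq x a")
    case True
    then show ?thesis using a by blast
  next
    case False
    then have "lexordp_eq a x" using lexordp_eq_linear by blast
    then show ?thesis using a lexordp_eq_trans lexordp_eq_refl by (metis insert_iff)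
  qed
qed (simp add: lexordp_eq_refl)

lemma not_lexordp_eq_obtain:
  assumes "\<not> lexordp_eq b (a :: int list)" "length b = length a"
  obtains k where "k < length a" "a ! k < b ! k" "\<And>i. i < k \<Longrightarrow> b ! i = a ! i"
proof -
  have "\<exists>k<length a. a ! k < b ! k \<and> (\<forall>i<k. b ! i = a ! i)"
    using assms
  proof (induction b arbitrary: a)
    case (Cons y ys)
    then obtain x xs where a: "a = x # xs" "length xs = length ys" by (cases a) auto
    show ?case
    proof (cases "x < y")
      case True
      then show ?thesis using a by (intro exI[of _ 0]) auto
    next
      case False
      then have "y = x" "\<not> lexordp_eq ys xs" using Cons.prems a by auto
      then obtain k where "k < length xs" "xs ! k < ys ! k" "\<forall>i<k. ys ! i = xs ! i"
        using Cons.IH[of xs] a by auto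
      then show ?thesis using a \<open>y = x\<close>
        by (intro exI[of _ "Suc k"]) (auto simp: less_Suc_eq_0_disj)
    qed
  qed simp
  then show ?thesis using that by blast
qed

definition GK_candidates :: "('a::field_char_0 \<Rightarrow> ereal) \<Rightarrow> 'a mat \<Rightarrow> int list set" where
  "GK_candidates v B = (\<Union>U \<in> GL_integers v (dim_row B). S v (form_subst B U))"

lemma GK_eqI:
  assumes "a \<in> GK_candidates v B" "\<And>b. b \<in> GK_candidates v B \<Longrightarrow> lexordp_eq b a"
  shows "GK v B = a"
  unfolding GK_def Let_def GK_candidates_def[symmetric]
  by (rule the_equality) (use assms in \<open>auto intro: lexordp_eq_antisym\<close>)

text \<open>As a definite description, \<open>GK\<close> bounds the candidates only once a maximum
  is known to exist; finiteness provides it.\<close>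

lemma GK_max:
  assumes "finite (GK_candidates v B)" "b \<in> GK_candidates v B"
  shows "lexordp_eq b (GK v B)"
proof -
  obtain a where a: "a \<in> GK_candidates v B" "\<forall>b\<in>GK_candidates v B. lexordp_eq b a"
    using lexordp_eq_finite_max[OF assms(1)] assms(2) by blast
  then have "GK v B = a" by (intro GK_eqI) auto
  then show ?thesis using a assms(2) by blast
qed

section \<open>Gram matrices and unimodular substitutions\<close>

lemma form_subst_index:
  assumes "B \<in> carrier_mat n n" "U \<in> carrier_mat n n" "k < n" "l < n"
  shows "form_subst B U $$ (k, l) = (\<Sum>r<n. \<Sum>s<n. U $$ (r, k) * B $$ (r, s) * U $$ (s, l))"
proof -
  have "form_subst B U $$ (k, l) = (\<Sum>r<n. U $$ (r, k) * (\<Sum>s<n. B $$ (r, s) * U $$ (s, l)))"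
    using assms by (auto simp: form_subst_def scalar_prod_def lessThan_atLeast0)
  then show ?thesis by (simp add: sum_distrib_left mult.assoc)
qed

lemma form_subst_symmetric:
  assumes "B \<in> carrier_mat n n" "U \<in> carrier_mat n n" "transpose_mat B = B"
  shows "transpose_mat (form_subst B U) = form_subst B U"
proof -
  have "transpose_mat (transpose_mat U * B * U) = transpose_mat U * transpose_mat (transpose_mat U * B)"
    by (rule transpose_mult[of _ n n]) (use assms in auto)
  also have "transpose_mat (transpose_mat U * B) = transpose_mat B * U"
    using transpose_mult[of "transpose_mat U" n n B n] assms by simp
  finally show ?thesis
    using assms unfolding form_subst_def by (simp add: assoc_mult_mat[of "transpose_mat U" n n B n U n])
qed

definition gram :: "'a::field_char_0 mat \<Rightarrow> nat \<Rightarrow> nat \<Rightarrow> 'a" where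
  "gram B i j = 2 * B $$ (i, j)"

lemma gram_form_subst:
  assumes "B \<in> carrier_mat n n" "U \<in> carrier_mat n n" "k < n" "l < n"
  shows "gram (form_subst B U) k l = (\<Sum>r<n. \<Sum>s<n. U $$ (r, k) * gram B r s * U $$ (s, l))"
  unfolding gram_def form_subst_index[OF assms] by (simp add: sum_distrib_left mult_ac)

context nonarch_local_field
begin

lemma GL_integersD:
  assumes "U \<in> GL_integers v n"
  shows "U \<in> carrier_mat n n" "\<And>i j. i < n \<Longrightarrow> j < n \<Longrightarrow> ge 0 (U $$ (i, j))"
    and "\<exists>V. (\<forall>i<n. \<forall>j<n. ge 0 (V i j)) \<and>
      (\<forall>i<n. \<forall>j<n. (\<Sum>r<n. U $$ (i, r) * V r j) = (if i = j then 1 else 0))"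
proof -
  have elem: "ge 0 (A $$ (i, j))" if "A \<in> carrier_mat n n" "elements_mat A \<subseteq> integers v" "i < n" "j < n" for A i j
  proof -
    have "A $$ (i, j) \<in> elements_mat A" using that(1,3,4) by (rule elements_matI) simp
    then show ?thesis using that(2) by (auto simp: integers_def ge_def zero_ereal_def)
  qed
  obtain V where V: "V \<in> carrier_mat n n" "elements_mat V \<subseteq> integers v" "U * V = 1\<^sub>m n"
    and U: "U \<in> carrier_mat n n" "elements_mat U \<subseteq> integers v"
    using assms by (auto simp: GL_integers_def)
  show "U \<in> carrier_mat n n" "\<And>i j. i < n \<Longrightarrow> j < n \<Longrightarrow> ge 0 (U $$ (i, j))" using U elem by auto
  have "(\<Sum>r<n. U $$ (i, r) * V $$ (r, j)) = (if i = j then 1 else 0)" if "i < n" "j < n" for i j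
  proof -
    have "(U * V) $$ (i, j) = (\<Sum>r<n. U $$ (i, r) * V $$ (r, j))"
      using that U(1) V(1) by (auto simp: scalar_prod_def lessThan_atLeast0)
    then show ?thesis using that V(3) by simp
  qed
  then show "\<exists>V. (\<forall>i<n. \<forall>j<n. ge 0 (V i j)) \<and>
      (\<forall>i<n. \<forall>j<n. (\<Sum>r<n. U $$ (i, r) * V r j) = (if i = j then 1 else 0))"
    using elem[OF V(1,2)] by (intro exI[of _ "\<lambda>i j. V $$ (i, j)"]) auto
qed

lemma gdet_form_subst:
  assumes "B \<in> carrier_mat n n" "U \<in> GL_integers v n"
  obtains e where "v e = 0" "gdet {..<n} (gram (form_subst B U)) = e\<^sup>2 * gdet {..<n} (gram B)"
proof -
  let ?u = "\<lambda>i j. U $$ (i, j)"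
  note U = GL_integersD[OF assms(2)]
  obtain V where V: "\<forall>i<n. \<forall>j<n. ge 0 (V i j)"
      "\<forall>i<n. \<forall>j<n. (\<Sum>r<n. U $$ (i, r) * V r j) = (if i = j then 1 else 0)" using U(3) by blast
  have "v (gdet {..<n} ?u) = 0" using U V by (intro v_gdet_unit[where y=V]) auto
  moreover have "gdet {..<n} (gram (form_subst B U)) = (gdet {..<n} ?u)\<^sup>2 * gdet {..<n} (gram B)"
    unfolding gdet_congruence[OF finite_lessThan, symmetric]
    by (rule gdet_cong) (simp_all add: gram_form_subst[OF assms(1) U(1)])
  ultimately show ?thesis by (rule that)
qed

lemma M_iff:
  assumes "B \<in> carrier_mat n n" "transpose_mat B = B" "length a = n" "\<forall>x\<in>set a. 0 \<le> x"
  shows "B \<in> \<M> v a \<longleftrightarrow> form_ge {..<n} (\<lambda>i. real_of_int (a ! i)) (gram B)"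
proof -
  have sym: "B $$ (i, j) = B $$ (j, i)" if "i < n" "j < n" for i j
    using assms(1,2) that by (metis carrier_matD index_transpose_mat(1))
  have pos: "0 \<le> a ! i" if "i < n" for i using assms that by auto
  have d: "0 \<le> v (B $$ (i, i))" if "i < n" "ereal (real_of_int (a ! i)) \<le> v (B $$ (i, i))" for i
    using that pos[of i] by (metis ereal_less_eq(5) of_int_0_le_iff order_trans)
  have o: "0 \<le> v (2 * B $$ (i, j))" if "i < n" "j < n" "ereal (real_of_int (a ! i + a ! j) / 2) \<le> v (2 * B $$ (i, j))" for i j
  proof -
    have "0 \<le> real_of_int (a ! i + a ! j) / 2" using pos that by simp
    then show ?thesis using that(3) by (metis ereal_less_eq(5) order_trans)
  qed
  show ?thesis
    unfolding \<M>_def half_integral_def form_ge_def gram_def ge_def integers_def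
    using assms d o sym by auto
qed

lemma GK_candidates_iff:
  assumes "B \<in> carrier_mat n n" "transpose_mat B = B"
  shows "b \<in> GK_candidates v B \<longleftrightarrow> length b = n \<and> sorted b \<and> (\<forall>x\<in>set b. 0 \<le> x) \<and>
    (\<exists>U \<in> GL_integers v n. form_ge {..<n} (\<lambda>i. real_of_int (b ! i)) (gram (form_subst B U)))"
proof -
  have "b \<in> S v (form_subst B U) \<longleftrightarrow> length b = n \<and> sorted b \<and> (\<forall>x\<in>set b. 0 \<le> x) \<and>
      form_ge {..<n} (\<lambda>i. real_of_int (b ! i)) (gram (form_subst B U))" if "U \<in> GL_integers v n" for U
  proof -
    note U = GL_integersD(1)[OF that]
    have "form_subst B U \<in> carrier_mat n n" using assms U by (auto simp: form_subst_def)
    then show ?thesis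
      using M_iff[OF _ form_subst_symmetric[OF assms(1) U assms(2)], of n b] unfolding S_def by auto
  qed
  then show ?thesis using assms unfolding GK_candidates_def by auto
qed

lemma one_mem_GL_integers: "1\<^sub>m n \<in> GL_integers v n"
proof -
  have "elements_mat (1\<^sub>m n) \<subseteq> integers v"
    by (auto simp: elements_mat_def integers_def v_zero)
  then show ?thesis unfolding GL_integers_def by (auto intro!: bexI[of _ "1\<^sub>m n"])
qed

text \<open>In every rank the determinant bound gives
  \<open>\<bar>b\<bar> \<le> ord (det (2 B))\<close>, a quantity invariant under unimodular
  substitutions. As the entries of \<open>b\<close> are nonnegative, it bounds each of them.\<close>

lemma finite_GK_candidates:
  assumes "B \<in> carrier_mat n n" "transpose_mat B = B" "gdet {..<n} (gram B) \<noteq> 0"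
  shows "finite (GK_candidates v B)"
proof -
  obtain k :: int where k: "v (gdet {..<n} (gram B)) = ereal (real_of_int k)"
    using v_nonzero_int assms(3) by blast
  have "set b \<subseteq> {0..k} \<and> length b = n" if b: "b \<in> GK_candidates v B" for b
  proof -
    from b obtain U where b: "length b = n" "\<forall>x\<in>set b. 0 \<le> x" "U \<in> GL_integers v n"
      "form_ge {..<n} (\<lambda>i. real_of_int (b ! i)) (gram (form_subst B U))"
      using GK_candidates_iff[OF assms(1,2)] by blast
    let ?d = "gdet {..<n} (gram (form_subst B U))" and ?s = "\<Sum>i<n. real_of_int (b ! i)"
    have "disc_bound {..<n} ?s (gram (form_subst B U))"
      using form_ge_disc_bound[OF _ b(4)] by simp
    moreover have "ge ?s ((-1) ^ (n div 2) * ?d) \<Longrightarrow> ge ?s ?d" by (cases "even (n div 2)") simp_all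
    ultimately have "ge ?s ?d"
      using is_disc_ge ge_mult_half by (auto simp: disc_bound_def split: if_splits)
    moreover obtain e where "v e = 0" "?d = e\<^sup>2 * gdet {..<n} (gram B)"
      using gdet_form_subst[OF assms(1) b(3)] by blast
    ultimately have "?s \<le> real_of_int k" by (simp add: v_mult power2_eq_square ge_def k)
    moreover have "real_of_int (b ! i) \<le> ?s" if "i < n" for i
      using that b by (intro member_le_sum) auto
    ultimately have "b ! i \<le> k" if "i < n" for i using that by (metis of_int_le_iff order_trans)
    then show ?thesis using b by (auto simp: in_set_conv_nth)
  qed
  then have "GK_candidates v B \<subseteq> {b. set b \<subseteq> {0..k} \<and> length b = n}" by blast
  then show ?thesis by (rule finite_subset) (simp add: finite_lists_length_eq)
qed

section \<open>Residual square roots and improvement of degenerate binary forms\<close>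

lemma gt_of_square: "gt t (x\<^sup>2) \<Longrightarrow> gt (t / 2) x"
proof (cases "x = 0")
  case False
  then obtain k :: int where "v x = ereal (real_of_int k)" by (rule v_nonzero_int)
  then show "gt t (x\<^sup>2) \<Longrightarrow> gt (t / 2) x" by (simp add: gt_def power2_eq_square v_mult)
qed simp

text \<open>
  Squaring is injective on the finite residue field, so the iterated squares of \<open>x\<close> return to \<open>x\<close>.
\<close>

lemma residue_sqrt:
  assumes "gt 0 2" "ge 0 x"
  obtains y where "ge 0 y" "gt 0 (y\<^sup>2 - x)"
proof -
  let ?R = "{(x, y). 0 \<le> v x \<and> 0 \<le> v y \<and> 1 \<le> v (x - y)}"
  define f where "f = (\<lambda>k::nat. x ^ 2 ^ k)"
  have f0: "ge 0 (f k)" for k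
    unfolding f_def using ge_prod[of "{..<2 ^ k :: nat}" "\<lambda>_. x"] assms(2) by simp
  have f_Suc: "f (Suc k) = (f k)\<^sup>2" for k by (simp add: f_def power_mult[symmetric] mult.commute)
  have one: "1 \<le> v z \<longleftrightarrow> gt 0 z" for z
    using gt_int_iff[of 0 z] by (simp add: ge_def one_ereal_def)
  have "?R `` {f k} \<in> {x. 0 \<le> v x} // ?R" for k
    using f0[of k] by (intro quotientI) (simp add: ge_def zero_ereal_def)
  then have "finite (range (\<lambda>k. ?R `` {f k}))"
    using finite_residue_field by (elim finite_subset[rotated]) auto
  then have "\<not> inj (\<lambda>k. ?R `` {f k})" using finite_imageD by blast
  then obtain i j where eq: "?R `` {f i} = ?R `` {f j}" and "i \<noteq> j" unfolding inj_on_def by blast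
  then have ne: "i < j \<or> j < i" by (simp add: neq_iff)
  have "f j \<in> ?R `` {f j}" using f0[of j] by (simp add: ge_def zero_ereal_def v_zero)
  then have "f j \<in> ?R `` {f i}" by (simp only: eq)
  then have ij: "gt 0 (f i - f j)" by (simp add: one)
  then have ji: "gt 0 (f j - f i)" using gt_minus[of 0 "f i - f j"] by simp
  obtain i k where eq: "gt 0 (f (i + Suc k) - f i)"
    using ne
  proof
    assume "i < j"
    then obtain k where "j = Suc (i + k)" using less_imp_Suc_add by blast
    then show ?thesis using that[of i k] ji by simp
  next
    assume "j < i"
    then obtain k where "i = Suc (j + k)" using less_imp_Suc_add by blast
    then show ?thesis using that[of j k] ij by simp
  qed
  \<comment> \<open>The start of the period is moved down to 0: since \<open>2\<close> vanishes in
    the residue field, \<open>(r - p)\<^sup>2\<close> is congruent to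
    \<open>r\<^sup>2 - p\<^sup>2\<close>, so a congruence of squares passes to the roots.\<close>
  have "gt 0 (f (i + Suc k) - f i) \<Longrightarrow> gt 0 (f (Suc k) - f 0)" for i
  proof (induction i)
    case (Suc i)
    define p r where "p = f i" and "r = f (i + Suc k)"
    have pr: "f (Suc i) = p\<^sup>2" "f (Suc i + Suc k) = r\<^sup>2"
      using f_Suc[of i] f_Suc[of "i + Suc k"] by (simp_all add: p_def r_def)
    have "ge 0 (p - r)" unfolding p_def r_def by (rule ge_diff[OF f0 f0])
    then have "gt 0 (p * (p - r) * 2)"
      using gt_mult[OF ge_mult[of 0 p 0 "p - r"] assms(1)] f0[of i] by (simp add: p_def)
    with Suc.prems have "gt 0 ((r\<^sup>2 - p\<^sup>2) + p * (p - r) * 2)"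
      unfolding pr by (rule gt_add)
    also have "(r\<^sup>2 - p\<^sup>2) + p * (p - r) * 2 = (r - p)\<^sup>2" by (simp add: algebra_simps power2_eq_square)
    finally have "gt 0 (f (i + Suc k) - f i)" using gt_of_square[of 0 "r - p"] by (simp add: p_def r_def)
    then show ?case by (rule Suc.IH)
  qed simp
  from this[OF eq] have "gt 0 ((f k)\<^sup>2 - x)" using f_Suc[of k] by (simp add: f_def)
  then show ?thesis using that f0 by blast
qed

text \<open>
  The residual form is a nonzero multiple of a square, and \<open>x\<close> moves the second basis vector into
  its radical.
\<close>

lemma binary_improve:
  assumes q: "v q = ereal (real_of_int m)" and r: "ge (real_of_int n) r" and b: "ge (real_of_int (m + n) / 2) b"
    and disc: "gt (real_of_int (m + n)) (b\<^sup>2 - 4 * (q * r))" and mn: "m \<le> n" "even (m + n)"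
  obtains x where "ge 0 x" "gt (real_of_int n) (r + b * x + q * x\<^sup>2)" "gt (real_of_int (m + n) / 2) (b + 2 * (q * x))"
proof (cases "gt 0 2")
  case False
  then have v2: "v 2 = ereal 0" using ge_2 by (simp add: ge_iff_gt_or)
  have v2q: "v (2 * q) = ereal (real_of_int m)" using v_mult_real[OF v2 q] by simp
  have v4q: "v (4 * q) = ereal (real_of_int m)" using v_mult_real[OF v2 v2q] by simp
  have q0: "q \<noteq> 0" using v_eq_real_imp_nonzero[OF q] .
  show ?thesis
  \<comment> \<open>Completing the square leaves minus the discriminant divided by
    \<open>4 * q\<close>.\<close>
  proof (rule that[of "- (b / (2 * q))"])
    show "ge 0 (- (b / (2 * q)))"
      using ge_mono[OF ge_divide[OF b v2q], of 0] mn by simp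
    have "gt (real_of_int (m + n) - real_of_int m) ((b\<^sup>2 - 4 * (q * r)) / (4 * q))"
      by (rule gt_divide[OF disc v4q])
    moreover have "r + b * - (b / (2 * q)) + q * (- (b / (2 * q)))\<^sup>2 = - ((b\<^sup>2 - 4 * (q * r)) / (4 * q))"
      using q0 by (simp add: field_simps power2_eq_square)
    ultimately show "gt (real_of_int n) (r + b * - (b / (2 * q)) + q * (- (b / (2 * q)))\<^sup>2)" by simp
    show "gt (real_of_int (m + n) / 2) (b + 2 * (q * - (b / (2 * q))))" using q0 by simp
  qed
next
  case two: True
  have "gt (real_of_int (m + n)) (2 * (q * r))"
    using gt_mult[OF ge_mult[OF ge_eq[OF q] r] two] by (simp add: mult_ac)
  from gt_mult[OF ge_2 this] have "gt (real_of_int (m + n)) (4 * (q * r))" by simp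
  from gt_add[OF disc this] have b: "gt (real_of_int (m + n) / 2) b"
    using gt_of_square by simp
  show ?thesis
  proof (cases "gt (real_of_int n) r")
    case True
    then show ?thesis using b by (intro that[of 0]) auto
  next
    case False
    then have vr: "v r = ereal (real_of_int n)" using r by (simp add: ge_iff_gt_or)
    \<comment> \<open>Evenness permits scaling by an element of valuation
      \<open>(n - m) / 2\<close>, which reduces \<open>q * x\<^sup>2 = - r\<close> to a square root
      in the residue field.\<close>
    have "even (n - m)" using mn(2) by presburger
    then obtain k where k: "n - m = 2 * k" by (rule evenE)
    have k': "real_of_int n = real_of_int m + 2 * real_of_int k" using k by linarith
    have k0: "0 \<le> k" using k mn(1) by linarith
    obtain \<pi> where p: "v \<pi> = ereal (real_of_int k)" by (rule uniformizer_power)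
    have vqp: "v (q * \<pi>\<^sup>2) = ereal (real_of_int n)"
      using v_mult_real[OF q v_mult_real[OF p p]] k' by (simp add: power2_eq_square)
    then have "ge 0 (- (r / (q * \<pi>\<^sup>2)))" using v_divide[OF vr vqp] by (simp add: ge_def)
    then obtain y where y: "ge 0 y" "gt 0 (y\<^sup>2 - - (r / (q * \<pi>\<^sup>2)))" by (rule residue_sqrt[OF two])
    have px: "ge (real_of_int k) (\<pi> * y)" using ge_mult[OF ge_eq[OF p] y(1)] by simp
    show ?thesis
    proof (rule that)
      show "ge 0 (\<pi> * y)" using px by (rule ge_mono) (use k0 in simp)
      have "gt (real_of_int n) (q * \<pi>\<^sup>2 * (y\<^sup>2 - - (r / (q * \<pi>\<^sup>2))))"
        using gt_mult[OF ge_eq[OF vqp] y(2)] by simp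
      moreover have "q * \<pi>\<^sup>2 * (y\<^sup>2 - - (r / (q * \<pi>\<^sup>2))) = r + q * (\<pi> * y)\<^sup>2"
        using v_eq_real_imp_nonzero[OF vqp] by (simp add: field_simps)
      moreover have "gt (real_of_int n) (b * (\<pi> * y))"
        using gt_mult'[OF px b, of "real_of_int n"] k' by (simp add: mult.commute)
      ultimately show "gt (real_of_int n) (r + b * (\<pi> * y) + q * (\<pi> * y)\<^sup>2)"
        using gt_add[of "real_of_int n" "r + q * (\<pi> * y)\<^sup>2" "b * (\<pi> * y)"] by (simp add: algebra_simps)
      have "gt (real_of_int (m + n) / 2) (q * (\<pi> * y) * 2)"
        using gt_mult'[OF ge_mult[OF ge_eq[OF q] px] two] k' by simp
      then show "gt (real_of_int (m + n) / 2) (b + 2 * (q * (\<pi> * y)))"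
        by (intro gt_add[OF b]) (simp add: mult.commute)
    qed
  qed
qed

end

section \<open>Binary forms\<close>

lemma gdet_gram:
  assumes "B \<in> carrier_mat n n"
  shows "gdet {..<n} (gram B) = 2 ^ n * det B"
proof -
  have "gdet {..<n} (gram B) = det (2 \<cdot>\<^sub>m B)"
    using assms by (subst det_eq_gdet[of _ n]) (auto simp: gram_def intro!: gdet_cong)
  then show ?thesis using assms by simp
qed

definition mat2 :: "'a \<Rightarrow> 'a \<Rightarrow> 'a \<Rightarrow> 'a \<Rightarrow> 'a mat" where
  "mat2 p s t u = mat 2 2 (\<lambda>(i, j). if i = 0 then if j = 0 then p else s else if j = 0 then t else u)"

lemma mat2_carrier [simp]: "mat2 p s t u \<in> carrier_mat 2 2"
  by (simp add: mat2_def)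

lemma mat2_index [simp]:
  "mat2 p s t u $$ (0, 0) = p" "mat2 p s t u $$ (0, Suc 0) = s"
  "mat2 p s t u $$ (Suc 0, 0) = t" "mat2 p s t u $$ (Suc 0, Suc 0) = u"
  by (simp_all add: mat2_def)

lemma mat2_mult: "mat2 p s t u * mat2 p' s' t' (u' :: 'a::comm_ring_1)
    = mat2 (p * p' + s * t') (p * s' + s * u') (t * p' + u * t') (t * s' + u * u')"
  by (intro eq_matI) (auto simp: mat2_def scalar_prod_def numeral_2_eq_2)

lemma mat2_one: "1\<^sub>m 2 = mat2 1 0 0 1"
  by (intro eq_matI) (auto simp: mat2_def)

context nonarch_local_field
begin

text \<open>The inverse is \<open>d\<close> times the adjugate, because the determinant
  \<open>d\<close> is its own inverse.\<close>

lemma mat2_GL_integers: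
  assumes "ge 0 p" "ge 0 s" "ge 0 t" "ge 0 u" "p * u - s * t = d" "d * d = 1"
  shows "mat2 p s t u \<in> GL_integers v 2"
proof -
  have elem: "elements_mat (mat2 a b c e) \<subseteq> integers v" if "ge 0 a" "ge 0 b" "ge 0 c" "ge 0 e" for a b c e
    using that by (auto simp: elements_mat_def mat2_def integers_def ge_def zero_ereal_def split: if_splits)
  have "d = 1 \<or> d = -1" using assms(6) by (simp add: square_eq_1_iff)
  then have d: "ge 0 (d * x)" if "ge 0 x" for x using that by auto
  have "d * (p * u - s * t) = 1" "d * (u * p - s * t) = 1" using assms(5,6) by (simp_all add: mult.commute)
  then have "mat2 p s t u * mat2 (d * u) (d * - s) (d * - t) (d * p) = 1\<^sub>m 2"
    "mat2 (d * u) (d * - s) (d * - t) (d * p) * mat2 p s t u = 1\<^sub>m 2"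
    unfolding mat2_mult mat2_one by (simp_all add: algebra_simps)
  moreover have "elements_mat (mat2 (d * u) (d * - s) (d * - t) (d * p)) \<subseteq> integers v"
    using assms by (intro elem d) auto
  ultimately show ?thesis
    using assms elem[of p s t u] unfolding GL_integers_def
    by (auto intro!: bexI[of _ "mat2 (d * u) (d * - s) (d * - t) (d * p)"])
qed

text \<open>The three expressions are the entries, the mixed one doubled, of the form after the
  substitution with columns \<open>(p, t)\<close> and \<open>(s, u)\<close>. Explicit substitutions
  thus bound \<open>GK\<close> from below.\<close>

lemma GK_binary_ge:
  assumes G: "G \<in> carrier_mat 2 2" "transpose_mat G = G" "nondegenerate G"
    and U: "ge 0 p" "ge 0 s" "ge 0 t" "ge 0 u" "p * u - s * t = d" "d * d = 1"
    and mn: "0 \<le> m" "m \<le> n"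
    and ge: "ge (real_of_int m) (p\<^sup>2 * G $$ (0, 0) + p * t * (2 * G $$ (0, 1)) + t\<^sup>2 * G $$ (1, 1))"
      "ge (real_of_int n) (s\<^sup>2 * G $$ (0, 0) + s * u * (2 * G $$ (0, 1)) + u\<^sup>2 * G $$ (1, 1))"
      "ge (real_of_int (m + n) / 2) (2 * (p * s * G $$ (0, 0)) + (p * u + s * t) * (2 * G $$ (0, 1)) + 2 * (t * u * G $$ (1, 1)))"
  shows "lexordp_eq [m, n] (GK v G)"
proof (rule GK_max)
  have sym: "G $$ (Suc 0, 0) = G $$ (0, Suc 0)"
    using G(1,2) by (metis carrier_matD index_transpose_mat(1) pos2 one_less_numeral_iff semiring_norm(76) One_nat_def)
  have "gdet {..<2} (gram G) \<noteq> 0" using G by (simp add: gdet_gram nondegenerate_def)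
  then show "finite (GK_candidates v G)" using G by (intro finite_GK_candidates[of G 2]) auto
  let ?U = "mat2 p s t u"
  let ?c = "gram (form_subst G ?U)"
  have lt2: "{..<2::nat} = {0, Suc 0}" by auto
  have c: "?c k l = (\<Sum>r\<in>{0, Suc 0}. \<Sum>z\<in>{0, Suc 0}. ?U $$ (r, k) * gram G r z * ?U $$ (z, l))"
    if "k < 2" "l < 2" for k l
    using gram_form_subst[OF G(1) mat2_carrier that] unfolding lt2 .
  have c00: "?c 0 0 / 2 = p\<^sup>2 * G $$ (0, 0) + p * t * (2 * G $$ (0, 1)) + t\<^sup>2 * G $$ (1, 1)"
    by (subst c) (auto simp: gram_def sym algebra_simps power2_eq_square)
  have c11: "?c (Suc 0) (Suc 0) / 2 = s\<^sup>2 * G $$ (0, 0) + s * u * (2 * G $$ (0, 1)) + u\<^sup>2 * G $$ (1, 1)"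
    by (subst c) (auto simp: gram_def sym algebra_simps power2_eq_square)
  have c01: "?c 0 (Suc 0) = 2 * (p * s * G $$ (0, 0)) + (p * u + s * t) * (2 * G $$ (0, 1)) + 2 * (t * u * G $$ (1, 1))"
    by (subst c) (auto simp: gram_def sym algebra_simps power2_eq_square)
  have c10: "?c (Suc 0) 0 = ?c 0 (Suc 0)"
    by (subst (1 2) c) (auto simp: gram_def sym algebra_simps power2_eq_square)
  have "form_ge {..<2} (\<lambda>i. real_of_int ([m, n] ! i)) ?c"
    unfolding form_ge_def lt2 using ge ge_mult_half[of _ "?c 0 0"] ge_mult_half[of _ "?c (Suc 0) (Suc 0)"]
    by (simp add: c00 c11 c10 c01 add.commute)
  moreover have "?U \<in> GL_integers v 2" by (rule mat2_GL_integers[OF U])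
  ultimately show "[m, n] \<in> GK_candidates v G"
    using mn GK_candidates_iff[OF G(1,2)] by auto
qed

text \<open>A discriminant of valuation above \<open>m + n\<close> would make the residual form
  degenerate, and a substitution would yield the larger candidate \<open>[m, n + 1]\<close> or
  \<open>[m + 1, m + 1]\<close>. Evenness makes \<open>(m + n) / 2\<close> integral, so a strict
  bound there gains a full unit, more than the half needed for \<open>[m, n + 1]\<close>.\<close>

lemma GK_binary:
  assumes G: "G \<in> carrier_mat 2 2" "transpose_mat G = G" "nondegenerate G"
    and form: "form_ge {..<2} (\<lambda>i. real_of_int ([m, n] ! i)) (gram G)"
    and mn: "0 \<le> m" "m \<le> n" "even (m + n)"
    and GK: "GK v G = [m, n]"
  shows "v (4 * (G $$ (0, 0) * G $$ (1, 1)) - (2 * G $$ (0, 1))\<^sup>2) = ereal (real_of_int (m + n))"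
    and "m < n \<Longrightarrow> v (G $$ (0, 0)) = ereal (real_of_int m)"
proof -
  define q r b where "q = G $$ (0, 0)" and "r = G $$ (1, 1)" and "b = 2 * G $$ (0, 1)"
  note better = GK_binary_ge[OF G, folded q_def r_def b_def, unfolded GK]
  have ge: "ge (real_of_int m) q" "ge (real_of_int n) r" "ge (real_of_int (m + n) / 2) b"
    using form_geD(1)[OF form, of 0 0] form_geD(1)[OF form, of 1 1] form_geD(2)[OF form, of 0 1]
    by (simp_all add: gram_def q_def r_def b_def)
  obtain h where h: "m + n = 2 * h" using mn(3) by (rule evenE)
  have h': "real_of_int (m + n) / 2 = real_of_int h" using h by simp
  have h2: "real_of_int m + real_of_int n = 2 * real_of_int h" using h by linarith
  have up: "ge (real_of_int (k + 1)) x" if "gt (real_of_int k) x" for k x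
    using that gt_int_iff[of k x] by simp
  \<comment> \<open>The form itself would admit \<open>[m + 1, m + 1]\<close>, which is
    lexicographically larger whatever \<open>n\<close> is.\<close>
  have not_all: False if "gt (real_of_int m) q" "gt (real_of_int m) r" "gt (real_of_int m) b"
  proof -
    have "ge (real_of_int (m + 1 + (m + 1)) / 2) b" by (rule ge_mono[OF up[OF that(3)]]) simp
    then have "lexordp_eq [m + 1, m + 1] [m, n]"
      by (intro better[of 1 0 0 1 1]) (use up[OF that(1)] up[OF that(2)] mn in auto)
    then show False by simp
  qed
  show vq: "m < n \<Longrightarrow> v (G $$ (0, 0)) = ereal (real_of_int m)"
  proof (rule ccontr)
    assume "m < n" and "v (G $$ (0, 0)) \<noteq> ereal (real_of_int m)"
    then have "gt (real_of_int m) q" using ge(1) by (simp add: q_def ge_iff_gt_or)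
    moreover have "gt (real_of_int m) r" by (rule ge_imp_gt[OF ge(2)]) (use \<open>m < n\<close> in simp)
    moreover have "gt (real_of_int m) b" by (rule ge_imp_gt[OF ge(3)]) (use \<open>m < n\<close> in simp)
    ultimately show False by (rule not_all)
  qed
  have "ge (real_of_int (m + n)) (b\<^sup>2)" by (rule ge_mono[OF ge_power2[OF ge(3)]]) simp
  moreover have "ge (real_of_int (m + n)) (4 * (q * r))" using ge_mult[OF ge_4 ge_mult[OF ge(1,2)]] by simp
  ultimately have geD: "ge (real_of_int (m + n)) (b\<^sup>2 - 4 * (q * r))" by (rule ge_diff)
  have "\<not> gt (real_of_int (m + n)) (b\<^sup>2 - 4 * (q * r))"
  proof
    assume disc: "gt (real_of_int (m + n)) (b\<^sup>2 - 4 * (q * r))"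
    have eq: "m = n" if "gt (real_of_int m) q"
      using that vq mn(2) by (cases "m < n") (auto simp: q_def gt_def)
    consider "v q = ereal (real_of_int m)" | "gt (real_of_int m) q" "v r = ereal (real_of_int m)" "m = n"
      | "gt (real_of_int m) q" "gt (real_of_int m) r" "m = n"
      using ge(1,2) eq unfolding ge_iff_gt_or by blast
    then show False
    proof cases
      case 1
      then obtain x where x: "ge 0 x" "gt (real_of_int n) (r + b * x + q * x\<^sup>2)"
        "gt (real_of_int (m + n) / 2) (b + 2 * (q * x))"
        using binary_improve[OF _ ge(2,3) disc mn(2,3)] by blast
      have "ge (real_of_int (m + (n + 1)) / 2) (b + 2 * (q * x))"
        by (rule ge_mono[OF up[OF x(3)[unfolded h']]]) (use h2 in simp)
      then have "lexordp_eq [m, n + 1] [m, n]"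
        by (intro better[of 1 x 0 1 1]) (use x(1) up[OF x(2)] ge(1) mn in \<open>auto simp: algebra_simps\<close>)
      then show False by simp
    next
      case 2
      \<comment> \<open>The two basis vectors exchange roles, whence the determinant -1 of the
        substitution below.\<close>
      have "gt (real_of_int (m + n)) (b\<^sup>2 - 4 * (r * q))" using disc by (simp add: mult.commute)
      moreover have "ge (real_of_int n) q" using ge(1) 2(3) by simp
      ultimately obtain x where x: "ge 0 x" "gt (real_of_int n) (q + b * x + r * x\<^sup>2)"
        "gt (real_of_int (m + n) / 2) (b + 2 * (r * x))"
        using binary_improve[OF 2(2) _ ge(3) _ mn(2,3)] by blast
      have "ge (real_of_int (m + (n + 1)) / 2) (b + 2 * (r * x))"
        by (rule ge_mono[OF up[OF x(3)[unfolded h']]]) (use h2 in simp)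
      then have "lexordp_eq [m, n + 1] [m, n]"
        by (intro better[of 0 1 1 x "-1"]) (use x(1) up[OF x(2)] 2 ge(2) mn in \<open>auto simp: algebra_simps\<close>)
      then show False by simp
    next
      case 3
      have "gt (real_of_int (m + n)) (4 * (q * r))"
        using gt_mult'[OF ge_4 gt_mult[OF ge(1) 3(2)]] 3(3) by simp
      from gt_add[OF disc this] have "gt (real_of_int (m + n) / 2) b" by (intro gt_of_square[of _ b]) simp
      then have "gt (real_of_int m) b" using 3(3) by simp
      with 3 show False using not_all by blast
    qed
  qed
  with geD have "v (- (b\<^sup>2 - 4 * (q * r))) = ereal (real_of_int (m + n))"
    by (simp only: ge_iff_gt_or v_minus) simp
  then show "v (4 * (G $$ (0, 0) * G $$ (1, 1)) - (2 * G $$ (0, 1))\<^sup>2) = ereal (real_of_int (m + n))"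
    by (simp add: q_def r_def b_def)
qed

end

section \<open>Truncation of a reduced form\<close>

lemma sum_involution_parity:
  fixes w :: "nat \<Rightarrow> int"
  assumes "finite I" "\<And>i. i \<in> I \<Longrightarrow> \<tau> i \<in> I \<and> \<tau> (\<tau> i) = i" "\<And>i. i \<in> I \<Longrightarrow> even (w i + w (\<tau> i))"
  shows "even (sum w I - sum w {i \<in> I. \<tau> i = i})"
  using assms
proof (induction "card I" arbitrary: I rule: less_induct)
  case less
  show ?case
  proof (cases "\<exists>i\<in>I. \<tau> i \<noteq> i")
    case True
    then obtain i where i: "i \<in> I" "\<tau> i \<noteq> i" by blast
    define J where "J = I - {i, \<tau> i}"
    have I: "I = insert i (insert (\<tau> i) J)" "i \<notin> J" "\<tau> i \<notin> J" "finite J"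
      using i less.prems(1,2) by (auto simp: J_def)
    have inv: "\<tau> k \<in> J \<and> \<tau> (\<tau> k) = k" if "k \<in> J" for k
    proof -
      have "k \<in> I" "k \<noteq> i" "k \<noteq> \<tau> i" using that by (auto simp: J_def)
      then show ?thesis using less.prems(2)[of k] less.prems(2)[OF i(1)] by (auto simp: J_def)
    qed
    have "even (sum w J - sum w {i \<in> J. \<tau> i = i})"
    proof (rule less.hyps)
      show "card J < card I" using I i(2) by simp
      show "even (w k + w (\<tau> k))" if "k \<in> J" for k using less.prems(3)[of k] that I by blast
    qed (use I inv in auto)
    moreover have "sum w I = (w i + w (\<tau> i)) + sum w J" using I i(2) by simp
    moreover have "{k \<in> I. \<tau> k = k} = {k \<in> J. \<tau> k = k}"
      using I i less.prems(2)[OF i(1)] by auto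
    ultimately show ?thesis using less.prems(3)[OF i(1)] by simp
  next
    case False
    then have "{i \<in> I. \<tau> i = i} = I" by auto
    then show ?thesis by simp
  qed
qed

lemma card_distinct_parity_le:
  fixes w :: "nat \<Rightarrow> int"
  assumes "\<And>i j. i \<in> Z \<Longrightarrow> j \<in> Z \<Longrightarrow> i \<noteq> j \<Longrightarrow> w i mod 2 \<noteq> w j mod 2"
  shows "card Z \<le> 2"
proof -
  have "inj_on (\<lambda>i. w i mod 2) Z" using assms by (auto intro!: inj_onI)
  moreover have "(\<lambda>i. w i mod 2) ` Z \<subseteq> {0, 1}" by auto
  ultimately have "card Z \<le> card {0, 1 :: int}" by (intro card_inj_on_le) auto
  then show ?thesis by simp
qed

text \<open>Each 2-cycle contributes an even amount and two fixed points of different parity an odd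
  one. This supplies the odd total weight for \<open>exact_disc_bound\<close>.\<close>

lemma odd_sum_involution:
  fixes w :: "nat \<Rightarrow> int"
  assumes "finite I" "\<And>i. i \<in> I \<Longrightarrow> \<tau> i \<in> I \<and> \<tau> (\<tau> i) = i" "\<And>i. i \<in> I \<Longrightarrow> even (w i + w (\<tau> i))"
    and "\<And>i j. i \<in> I \<Longrightarrow> j \<in> I \<Longrightarrow> \<tau> i = i \<Longrightarrow> \<tau> j = j \<Longrightarrow> i \<noteq> j \<Longrightarrow> w i mod 2 \<noteq> w j mod 2"
    and "card {i \<in> I. \<tau> i = i} = 2"
  shows "\<exists>m. (\<Sum>i\<in>I. real_of_int (w i)) = 2 * real_of_int m + 1"
proof -
  obtain i j where ij: "{i \<in> I. \<tau> i = i} = {i, j}" "i \<noteq> j" using assms(5) unfolding card_2_iff by blast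
  then have "i \<in> {i \<in> I. \<tau> i = i}" "j \<in> {i \<in> I. \<tau> i = i}" by simp_all
  then have "w i mod 2 \<noteq> w j mod 2" using assms(4)[of i j] ij(2) by blast
  then have "odd (w i + w j)" by presburger
  moreover have "even (sum w I - (w i + w j))"
    using sum_involution_parity[of I \<tau> w, OF assms(1-3)] ij by simp
  ultimately have "odd (sum w I)" by presburger
  then obtain m where "sum w I = 2 * m + 1" by (rule oddE)
  then have "real_of_int (sum w I) = 2 * real_of_int m + 1" by simp
  then show ?thesis by auto
qed

context nonarch_local_field
begin

lemma form_ge_add: "form_ge I w c \<Longrightarrow> form_ge I w d \<Longrightarrow> form_ge I w (\<lambda>i j. c i j + d i j)"
  by (auto simp: form_ge_def add_divide_distrib intro!: ge_add)

lemma form_ge_mono: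
  assumes "form_ge I w c" "\<And>i. i \<in> I \<Longrightarrow> u i \<le> w i"
  shows "form_ge I u c"
proof -
  have "(u i + u j) / 2 \<le> (w i + w j) / 2" if "i \<in> I" "j \<in> I" for i j
    using assms(2)[OF that(1)] assms(2)[OF that(2)] by simp
  then show ?thesis using assms unfolding form_ge_def by (blast intro: ge_mono)
qed

text \<open>Bounds with a constant weight are stable under every integral substitution. This is why
  a change of the form of valuation at least \<open>A + 1\<close> is invisible to candidates cut off
  there.\<close>

lemma form_ge_congruence:
  assumes fin: "finite I" and form: "form_ge I (\<lambda>_. t) p"
    and x: "\<And>i j. i \<in> I \<Longrightarrow> j \<in> I \<Longrightarrow> ge 0 (x i j)"
  shows "form_ge I (\<lambda>_. t) (\<lambda>k l. \<Sum>r\<in>I. \<Sum>s\<in>I. x r k * p r s * x s l)"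
proof -
  note D = form_geD[OF form]
  have "ge t ((\<Sum>r\<in>I. \<Sum>s\<in>I. x r k * p r s * x s k) / 2)" if "k \<in> I" for k
    using ge_form_half[OF fin form, of "t / 2" "\<lambda>s. x s k"] x that by simp
  moreover have "ge t (\<Sum>r\<in>I. \<Sum>s\<in>I. x r k * p r s * x s l)" if "k \<in> I" "l \<in> I" for k l
  proof (intro ge_sum)
    fix r s assume rs: "r \<in> I" "s \<in> I"
    show "ge t (x r k * p r s * x s l)"
      using ge_mult[OF ge_mult[OF x[of r k] D(2)[of r s]] x[of s l]] rs that by simp
  qed
  moreover have "(\<Sum>r\<in>I. \<Sum>s\<in>I. x r k * p r s * x s l) = (\<Sum>r\<in>I. \<Sum>s\<in>I. x r l * p r s * x s k)" for k l
  proof -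
    have "(\<Sum>r\<in>I. \<Sum>s\<in>I. x r k * p r s * x s l) = (\<Sum>s\<in>I. \<Sum>r\<in>I. x r k * p r s * x s l)"
      by (rule sum.swap)
    also have "\<dots> = (\<Sum>s\<in>I. \<Sum>r\<in>I. x s l * p s r * x r k)"
    proof (intro sum.cong refl)
      fix s r assume "s \<in> I" "r \<in> I"
      then have "p r s = p s r" by (intro D(3))
      then show "x r k * p r s * x s l = x s l * p s r * x r k" by (simp add: mult_ac)
    qed
    finally show ?thesis .
  qed
  ultimately show ?thesis unfolding form_ge_def by simp
qed

end

text \<open>
  Comparison with a candidate exceeding \<open>a\<close> first at an index of weight \<open>A\<close>: all weights are cut
  off at \<open>M = A + 1\<close>, and the form is changed modulo elements of valuation at least \<open>M\<close>, which no
  candidate with the same cut-off can detect. The indices of weight above \<open>A\<close> not needed by a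
  pair (the set \<open>upper\<close>) are made orthogonal to each other and paired with auxiliary copies, so that
  the residual form becomes nonsingular.
\<close>

locale truncation = nonarch_local_field +
  fixes n :: nat and a :: "nat \<Rightarrow> int" and \<sigma> :: "nat \<Rightarrow> nat" and c :: "nat \<Rightarrow> nat \<Rightarrow> 'a" and A :: int and \<pi> :: 'a
  assumes form: "form_ge {..<n} (\<lambda>i. real_of_int (a i)) c"
    and inv: "\<And>i. i < n \<Longrightarrow> \<sigma> i < n \<and> \<sigma> (\<sigma> i) = i"
    and pair: "\<And>i. i < n \<Longrightarrow> \<sigma> i \<noteq> i \<Longrightarrow> v (pair_disc c i (\<sigma> i)) = ereal (real_of_int (a i) + real_of_int (a (\<sigma> i)))"
    and par: "\<And>i. i < n \<Longrightarrow> even (a i + a (\<sigma> i))"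
    and diag: "\<And>i. i < n \<Longrightarrow> \<sigma> i = i \<or> a i < a (\<sigma> i) \<Longrightarrow> v (c i i / 2) = ereal (real_of_int (a i))"
    and strict: "\<And>i j. i < n \<Longrightarrow> j < n \<Longrightarrow> j \<noteq> i \<Longrightarrow> j \<noteq> \<sigma> i \<Longrightarrow>
      gt ((real_of_int (a i) + real_of_int (a j)) / 2) (c i j)"
    and sep: "\<And>i j. i < n \<Longrightarrow> j < n \<Longrightarrow> i \<noteq> j \<Longrightarrow> a i \<le> A \<Longrightarrow> a j \<le> A \<Longrightarrow>
      \<sigma> i = i \<or> A < a (\<sigma> i) \<Longrightarrow> \<sigma> j = j \<or> A < a (\<sigma> j) \<Longrightarrow> a i mod 2 \<noteq> a j mod 2"
    and \<pi>: "v \<pi> = ereal (real_of_int (A + 1))"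
begin

text \<open>A pair with one weight at most \<open>A\<close> and the other exactly
  \<open>A + 1\<close> is untouched by the cut and stays a pair, so its index of weight
  \<open>A + 1\<close> is left out. If the larger weight exceeds \<open>A + 1\<close>, the pair no
  longer attains its lowered weights and is broken up.\<close>

definition upper :: "nat set" where
  "upper = {i. i < n \<and> A < a i \<and> \<not> (a i = A + 1 \<and> a (\<sigma> i) \<le> A)}"

definition I where "I = {..<n} \<union> (\<lambda>j. j + n) ` upper"

definition w :: "nat \<Rightarrow> int" where "w i = (if i < n then min (a i) (A + 1) else A + 1)"

text \<open>An index outside \<open>upper\<close> whose partner lies in \<open>upper\<close> has
  lost that partner and becomes a unary summand.\<close>

definition \<tau> where "\<tau> i = (if i \<ge> n then i - n else if i \<in> upper then i + n
  else if \<sigma> i \<in> upper then i else \<sigma> i)"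

text \<open>On an index of \<open>upper\<close> and its copy this is a hyperbolic plane scaled by
  \<open>\<pi>\<close>; its determinant \<open>- \<pi>\<^sup>2\<close> has valuation exactly
  \<open>2 * (A + 1)\<close>.\<close>

definition d where "d i j = (if i < n \<and> j < n then if i \<in> upper \<and> j \<in> upper then 0 else c i j
  else if j = i + n \<or> i = j + n then \<pi> else 0)"

lemma finite_I: "finite I"
  by (simp add: I_def upper_def)

lemma I_cases:
  assumes "i \<in> I"
  obtains "i < n" "i \<notin> upper" "w i = a i" "a i \<le> A \<or> a i = A + 1 \<and> a (\<sigma> i) \<le> A"
  | "i < n" "i \<in> upper" "w i = A + 1" "A + 1 \<le> a i"
  | j where "i = j + n" "j < n" "j \<in> upper" "w i = A + 1"
proof (cases "i < n")
  case True
  show ?thesis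
  proof (cases "i \<in> upper")
    case u: True
    then have "w i = A + 1" "A + 1 \<le> a i" by (auto simp: upper_def w_def)
    with u True show ?thesis by (intro that(2))
  next
    case u: False
    then have "a i \<le> A \<or> a i = A + 1 \<and> a (\<sigma> i) \<le> A" using True by (auto simp: upper_def)
    moreover from this have "w i = a i" using True by (auto simp: w_def)
    ultimately show ?thesis using u True by (intro that(1))
  qed
next
  case False
  then obtain j where "j \<in> upper" "i = j + n" using assms by (auto simp: I_def)
  then show ?thesis by (intro that(3)[of j]) (auto simp: upper_def w_def)
qed

lemma w_le: "i < n \<Longrightarrow> w i \<le> a i"
  by (simp add: w_def)

lemma \<tau>_involution:
  assumes "i \<in> I"
  shows "\<tau> i \<in> I \<and> \<tau> (\<tau> i) = i"
  using assms
proof (cases rule: I_cases)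
  case 1
  then show ?thesis using inv[of i] by (auto simp: \<tau>_def I_def)
qed (auto simp: \<tau>_def I_def)

text \<open>The unary summands are thus among the indices whose diagonal entry is controlled by
  \<open>diag\<close> and whose parities are separated by \<open>sep\<close>.\<close>

lemma \<tau>_fixed:
  assumes "i \<in> I" "\<tau> i = i"
  shows "i < n \<and> a i \<le> A \<and> w i = a i \<and> (\<sigma> i = i \<or> A < a (\<sigma> i))"
  using assms(1)
proof (cases rule: I_cases)
  case 1
  then have s: "\<sigma> i \<in> upper \<or> \<sigma> i = i" using assms(2) by (auto simp: \<tau>_def split: if_splits)
  then have "\<not> a (\<sigma> i) \<le> A \<or> \<sigma> i = i" by (auto simp: upper_def)
  then show ?thesis using 1 by auto
qed (use assms(2) in \<open>auto simp: \<tau>_def\<close>)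

lemma \<tau>_parity:
  assumes "i \<in> I"
  shows "even (w i + w (\<tau> i))"
  using assms
proof (cases rule: I_cases)
  case 1
  show ?thesis
  proof (cases "\<sigma> i \<in> upper")
    case False
    then have "\<tau> i = \<sigma> i" "\<sigma> i \<in> I" using 1 inv[of i] by (auto simp: \<tau>_def I_def)
    moreover have "w (\<sigma> i) = a (\<sigma> i)" using False inv[OF 1(1)] by (auto simp: upper_def w_def)
    ultimately show ?thesis using 1 par by simp
  qed (use 1 in \<open>simp add: \<tau>_def\<close>)
qed (auto simp: \<tau>_def w_def upper_def)

lemma d_form_ge: "form_ge I (\<lambda>i. real_of_int (w i)) d"
proof -
  note D = form_geD[OF form, simplified]
  have \<pi>0: "ge (real_of_int A + 1) \<pi>" using ge_eq[OF \<pi>] by simp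
  have "ge (real_of_int (w i)) (d i i / 2)" if "i \<in> I" for i
  proof (cases "i < n")
    case True
    then have "ge (real_of_int (w i)) (c i i / 2)" using D(1)[of i i] w_le by (auto intro: ge_mono)
    then show ?thesis using True by (simp add: d_def)
  next
    case False
    moreover have "0 < n" using that by (auto simp: I_def upper_def)
    ultimately show ?thesis by (simp add: d_def)
  qed
  moreover have "ge ((real_of_int (w i) + real_of_int (w j)) / 2) (d i j)" if "i \<in> I" "j \<in> I" for i j
  proof (cases "i < n \<and> j < n")
    case True
    then have "ge ((real_of_int (w i) + real_of_int (w j)) / 2) (c i j)"
      using w_le[of i] w_le[of j] by (intro ge_mono[OF D(2)]) auto
    then show ?thesis using True by (simp add: d_def)
  next
    case False
    have "w k \<le> A + 1" for k by (simp add: w_def)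
    then have "real_of_int (w i) \<le> real_of_int A + 1" "real_of_int (w j) \<le> real_of_int A + 1"
      by (metis of_int_le_iff of_int_1 of_int_add)+
    then have "ge ((real_of_int (w i) + real_of_int (w j)) / 2) \<pi>" by (intro ge_mono[OF \<pi>0]) simp
    moreover have "d i j = 0 \<or> d i j = \<pi>" using False by (auto simp: d_def)
    ultimately show ?thesis by auto
  qed
  moreover have "d i j = d j i" for i j using D(3)[of i j] by (auto simp: d_def)
  ultimately show ?thesis unfolding form_ge_def by blast
qed

lemma d_diag:
  assumes "i \<in> I" "\<tau> i = i"
  shows "v (d i i / 2) = ereal (real_of_int (w i))"
proof -
  note i = \<tau>_fixed[OF assms]
  then have "i \<notin> upper" by (auto simp: upper_def)
  then show ?thesis using i diag[of i] by (auto simp: d_def)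
qed

lemma d_pair:
  assumes "i \<in> I" "\<tau> i \<noteq> i"
  shows "v (pair_disc d i (\<tau> i)) = ereal (real_of_int (w i) + real_of_int (w (\<tau> i)))"
proof -
  have pp: "v (- (\<pi> * \<pi>)) = ereal (real_of_int (A + 1) + real_of_int (A + 1))"
    using v_mult_real[OF \<pi> \<pi>] by simp
  show ?thesis
    using assms(1)
  proof (cases rule: I_cases)
    case 1
    then have t: "\<tau> i = \<sigma> i" "\<sigma> i \<notin> upper" using assms(2) by (auto simp: \<tau>_def split: if_splits)
    moreover have "w (\<sigma> i) = a (\<sigma> i)" using t(2) inv[OF 1(1)] by (auto simp: upper_def w_def)
    ultimately show ?thesis using 1 inv[OF 1(1)] pair[OF 1(1)] assms(2) by (simp add: pair_disc_def d_def)
  next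
    case 2
    then show ?thesis using pp by (simp add: pair_disc_def d_def \<tau>_def w_def)
  next
    case (3 j)
    then show ?thesis using pp by (simp add: pair_disc_def d_def \<tau>_def w_def upper_def)
  qed
qed

text \<open>The delicate case is a 2-cycle of \<open>\<sigma>\<close> broken up by
  \<open>\<tau>\<close> with just one index in \<open>upper\<close>: that index has weight above
  \<open>A + 1\<close>, so the cut lowers it strictly and the weak bound for \<open>c\<close>
  becomes strict.\<close>

lemma d_strict:
  assumes "i \<in> I" "j \<in> I" "j \<noteq> i" "j \<noteq> \<tau> i"
  shows "gt ((real_of_int (w i) + real_of_int (w j)) / 2) (d i j)"
proof (cases "i < n \<and> j < n \<and> \<not> (i \<in> upper \<and> j \<in> upper)")
  case True
  have "gt ((real_of_int (w i) + real_of_int (w j)) / 2) (c i j)"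
  proof (cases "j = \<sigma> i")
    case False
    then show ?thesis using True assms(3) w_le[of i] w_le[of j] by (intro gt_mono[OF strict]) auto
  next
    case s: True
    then have si: "\<sigma> j = i" using inv True by auto
    have "real_of_int (w i) + real_of_int (w j) < real_of_int (a i) + real_of_int (a j)"
    proof -
      have lt: "w k < a k" if "k \<in> upper" "\<sigma> k < n" "\<sigma> k \<notin> upper" "k < n" "\<sigma> (\<sigma> k) = k" for k
        using that by (auto simp: upper_def w_def)
      have "\<tau> i = j" if "i \<notin> upper" "j \<notin> upper" using that s True by (simp add: \<tau>_def)
      then have "i \<in> upper \<or> j \<in> upper" using assms(4) by blast
      then have "w i < a i \<or> w j < a j" using lt[of i] lt[of j] True s si by auto
      then have "w i + w j < a i + a j" using w_le[of i] w_le[of j] True by auto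
      then show ?thesis by (metis of_int_add of_int_less_iff)
    qed
    moreover have "ge ((real_of_int (a i) + real_of_int (a j)) / 2) (c i j)"
      using form_geD(2)[OF form, of i j] True by simp
    ultimately show ?thesis by (intro ge_imp_gt[of _ "c i j"]) auto
  qed
  then show ?thesis using True by (auto simp: d_def)
next
  case False
  have "j \<noteq> i + n"
  proof
    assume j: "j = i + n"
    then have "i \<in> upper" using assms(2) by (auto simp: I_def)
    then have "\<tau> i = j" using j by (simp add: \<tau>_def upper_def)
    then show False using assms(4) by simp
  qed
  moreover have "i \<noteq> j + n" using assms(4) by (auto simp: \<tau>_def)
  ultimately have "d i j = 0" using False by (auto simp: d_def)
  then show ?thesis by simp
qed

lemma split_form_d: "split_form I (\<lambda>i. real_of_int (w i)) \<tau> d"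
  unfolding split_form_def using d_form_ge \<tau>_involution d_diag d_pair d_strict by blast

lemma d_perturbation:
  "form_ge I (\<lambda>_. real_of_int (A + 1)) (\<lambda>i j. d i j - (if i < n \<and> j < n then c i j else 0))"
proof -
  note D = form_geD[OF form, simplified]
  let ?p = "\<lambda>i j. d i j - (if i < n \<and> j < n then c i j else 0)"
  have up: "real_of_int A + 1 \<le> real_of_int (a i)" if "i \<in> upper" for i
  proof -
    have "A + 1 \<le> a i" using that by (simp add: upper_def)
    then show ?thesis by linarith
  qed
  have \<pi>0: "ge ((real_of_int (A + 1) + real_of_int (A + 1)) / 2) \<pi>"
    by (rule ge_mono[OF ge_eq[OF \<pi>]]) simp
  have "ge (real_of_int (A + 1)) (?p i i / 2)" if "i \<in> I" for i
  proof (cases "i \<in> upper")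
    case True
    then have "ge (real_of_int (A + 1)) (c i i / 2)" using up by (intro ge_mono[OF D(1)]) (auto simp: upper_def)
    then show ?thesis using True by (simp add: d_def upper_def)
  next
    case False
    moreover have "0 < n" using that by (auto simp: I_def upper_def)
    ultimately show ?thesis by (simp add: d_def)
  qed
  moreover have "ge ((real_of_int (A + 1) + real_of_int (A + 1)) / 2) (?p i j)" for i j
  proof (cases "i \<in> upper \<and> j \<in> upper")
    case True
    then have "ge ((real_of_int (A + 1) + real_of_int (A + 1)) / 2) (c i j)"
      using up[of i] up[of j] by (intro ge_mono[OF D(2)]) (auto simp: upper_def)
    then show ?thesis using True by (simp add: d_def upper_def)
  next
    case False
    then have "?p i j = 0 \<or> ?p i j = \<pi>" by (auto simp: d_def)
    then show ?thesis using \<pi>0 by auto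
  qed
  moreover have "?p i j = ?p j i" for i j using D(3)[of i j] by (auto simp: d_def)
  ultimately show ?thesis unfolding form_ge_def by blast
qed

text \<open>The substitution is extended by the identity on the copies. The transform of
  \<open>c\<close> satisfies the cut weights of \<open>b\<close>, and that of the change has the
  constant weight \<open>A + 1\<close>, so the transform of \<open>d\<close> satisfies the cut
  weights too. By \<open>split_form_maximal\<close> their sum is at most that of the cut weights of
  \<open>a\<close>, and entrywise domination leaves only equality.\<close>

lemma candidate_bound:
  assumes u: "\<And>i j. i < n \<Longrightarrow> j < n \<Longrightarrow> ge 0 (u i j)"
    and y: "\<And>i j. i < n \<Longrightarrow> j < n \<Longrightarrow> ge 0 (y i j)"
      "\<And>i j. i < n \<Longrightarrow> j < n \<Longrightarrow> (\<Sum>r<n. u i r * y r j) = (if i = j then 1 else 0)"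
    and b: "form_ge {..<n} (\<lambda>i. real_of_int (b i)) (\<lambda>k l. \<Sum>r<n. \<Sum>s<n. u r k * c r s * u s l)"
    and le: "\<And>i. i < n \<Longrightarrow> min (a i) (A + 1) \<le> min (b i) (A + 1)"
  shows "i < n \<Longrightarrow> min (b i) (A + 1) = min (a i) (A + 1)"
proof -
  define ext where "ext = (\<lambda>x i j. if i < n \<and> j < n then x i j else if i = j then 1 else (0::'a))"
  define c0 where "c0 = (\<lambda>i j. if i < n \<and> j < n then c i j else 0)"
  define w' where "w' = (\<lambda>i. if i < n then min (b i) (A + 1) else A + 1)"
  define cong where "cong = (\<lambda>p k l. \<Sum>r\<in>I. \<Sum>s\<in>I. ext u r k * p r s * ext u s l)"
  have sub: "{..<n} \<subseteq> I" by (simp add: I_def)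
  have cut: "(\<Sum>r\<in>I. f r) = (\<Sum>r<n. f r)" if "\<And>r. r \<in> I \<Longrightarrow> \<not> r < n \<Longrightarrow> f r = 0" for f :: "nat \<Rightarrow> 'a"
    using that by (intro sum.mono_neutral_right finite_I sub) auto
  have ext0: "ge 0 (ext x i j)" if "\<And>i j. i < n \<Longrightarrow> j < n \<Longrightarrow> ge 0 (x i j)" for x i j
    using that by (simp add: ext_def)
  have unit: "v (gdet I (ext u)) = 0"
  proof (rule v_gdet_unit[OF finite_I, of _ "ext y"])
    fix k l assume "k \<in> I" "l \<in> I"
    show "(\<Sum>r\<in>I. ext u k r * ext y r l) = (if k = l then 1 else 0)"
    proof (cases "k < n")
      case True
      then have "(\<Sum>r\<in>I. ext u k r * ext y r l) = (\<Sum>r<n. ext u k r * ext y r l)"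
        by (intro cut) (auto simp: ext_def)
      also have "\<dots> = (if k = l then 1 else 0)"
        using True y(2)[of k l] by (cases "l < n") (auto simp: ext_def)
      finally show ?thesis .
    next
      case False
      then have "(\<Sum>r\<in>I. ext u k r * ext y r l) = (\<Sum>r\<in>I. if k = r then ext y k l else 0)"
        by (intro sum.cong) (auto simp: ext_def)
      also have "\<dots> = ext y k l" using \<open>k \<in> I\<close> finite_I by simp
      finally show ?thesis using False by (auto simp: ext_def)
    qed
  qed (use u y ext0 in auto)
  have c0: "cong c0 k l = (if k < n \<and> l < n then \<Sum>r<n. \<Sum>s<n. u r k * c r s * u s l else 0)" for k l
  proof -
    have "cong c0 k l = (\<Sum>r<n. \<Sum>s\<in>I. ext u r k * c0 r s * ext u s l)"
      unfolding cong_def by (intro cut) (simp add: c0_def)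
    also have "\<dots> = (\<Sum>r<n. \<Sum>s<n. ext u r k * c0 r s * ext u s l)"
      by (intro sum.cong refl cut) (simp add: c0_def)
    also have "\<dots> = (if k < n \<and> l < n then \<Sum>r<n. \<Sum>s<n. u r k * c r s * u s l else 0)"
      by (auto simp: ext_def c0_def intro!: sum.cong sum.neutral)
    finally show ?thesis .
  qed
  have "form_ge I (\<lambda>i. real_of_int (w' i)) (cong c0)"
  proof -
    have w'b: "real_of_int (w' k) \<le> real_of_int (b k)" if "k < n" for k using that by (simp add: w'_def)
    have "ge (real_of_int (w' k)) (cong c0 k k / 2)" for k
      using ge_mono[OF form_geD(1)[OF b, of k k] w'b[of k]] by (simp add: c0)
    moreover have "ge ((real_of_int (w' k) + real_of_int (w' l)) / 2) (cong c0 k l)" for k l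
    proof (cases "k < n \<and> l < n")
      case True
      then have "(real_of_int (w' k) + real_of_int (w' l)) / 2 \<le> (real_of_int (b k) + real_of_int (b l)) / 2"
        using w'b[of k] w'b[of l] by simp
      then show ?thesis using ge_mono[OF form_geD(2)[OF b, of k l]] True by (simp add: c0)
    qed (auto simp: c0)
    moreover have "cong c0 k l = cong c0 l k" for k l
      using form_geD(3)[OF b, of k l] by (auto simp: c0)
    ultimately show ?thesis unfolding form_ge_def by blast
  qed
  moreover have "form_ge I (\<lambda>i. real_of_int (w' i)) (cong (\<lambda>i j. d i j - c0 i j))"
    unfolding cong_def
    by (rule form_ge_mono[OF form_ge_congruence[OF finite_I d_perturbation[folded c0_def[THEN fun_cong, THEN fun_cong]]]])
      (use u ext0 in \<open>auto simp: w'_def\<close>)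
  ultimately have "form_ge I (\<lambda>i. real_of_int (w' i)) (\<lambda>k l. cong c0 k l + cong (\<lambda>i j. d i j - c0 i j) k l)"
    by (rule form_ge_add)
  moreover have "cong c0 k l + cong (\<lambda>i j. d i j - c0 i j) k l = cong d k l" for k l
    by (simp add: cong_def algebra_simps flip: sum.distrib)
  ultimately have form': "form_ge I (\<lambda>i. real_of_int (w' i)) (cong d)" by simp
  have det: "gdet I (cong d) = (gdet I (ext u))\<^sup>2 * gdet I d"
    unfolding cong_def by (rule gdet_congruence[OF finite_I])
  have parity: "w i mod 2 \<noteq> w j mod 2" if "i \<in> I" "j \<in> I" "\<tau> i = i" "\<tau> j = j" "i \<noteq> j" for i j
    using \<tau>_fixed[of i] \<tau>_fixed[of j] sep[of i j] that by auto
  have "(\<Sum>i\<in>I. real_of_int (w' i)) < (\<Sum>i\<in>I. real_of_int (w i)) + 1"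
  proof (rule split_form_maximal[OF finite_I split_form_d form' det unit])
    show "card {i \<in> I. \<tau> i = i} \<le> 2" by (rule card_distinct_parity_le[of _ w]) (use parity in auto)
    show "\<exists>m. (\<Sum>i\<in>I. real_of_int (w i)) = 2 * real_of_int m + 1" if "card {i \<in> I. \<tau> i = i} = 2"
      using odd_sum_involution[of I \<tau> w, OF finite_I \<tau>_involution \<tau>_parity parity that] by blast
  qed
  then have "real_of_int (sum w' I) < real_of_int (sum w I + 1)" by simp
  then have S: "sum w' I \<le> sum w I" unfolding of_int_less_iff by simp
  have le': "w j \<le> w' j" for j using le[of j] by (simp add: w_def w'_def)
  show "min (b i) (A + 1) = min (a i) (A + 1)" if i: "i < n"
  proof (rule ccontr)
    assume "min (b i) (A + 1) \<noteq> min (a i) (A + 1)"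
    then have "min (a i) (A + 1) < min (b i) (A + 1)" using le[OF i] by linarith
    then have "w i < w' i" by (simp only: w_def w'_def i if_True)
    then have "sum w I < sum w' I"
      using le' i by (intro sum_strict_mono_ex1 finite_I) (auto simp: I_def)
    then show False using S by simp
  qed
qed

end

section \<open>Reduced forms\<close>

lemma pair_submatrix_carrier: "pair_submatrix B i j \<in> carrier_mat 2 2"
  by (simp add: pair_submatrix_def mat_of_rows_list_def numeral_2_eq_2)

lemma pair_submatrix_index:
  "pair_submatrix B i j $$ (0, 0) = B $$ (i, i)" "pair_submatrix B i j $$ (0, Suc 0) = B $$ (i, j)"
  "pair_submatrix B i j $$ (Suc 0, 0) = B $$ (i, j)" "pair_submatrix B i j $$ (Suc 0, Suc 0) = B $$ (j, j)"
  by (simp_all add: pair_submatrix_def mat_of_rows_list_def)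

lemma pair_submatrix_symmetric: "transpose_mat (pair_submatrix B i j) = pair_submatrix B i j"
  using pair_submatrix_carrier[of B i j]
  by (intro eq_matI) (auto simp: pair_submatrix_index less_2_cases_iff)

section \<open>Combinatorics of admissible involutions\<close>

lemma P_minus_partner_parity:
  assumes "admissible a \<sigma>" "i \<in> P_minus a \<sigma>"
  shows "a ! \<sigma> i mod 2 = a ! i mod 2"
  using assms unfolding admissible_def is_min_of_def by fastforce

lemma admissible_involution:
  assumes "admissible a \<sigma>" "i < length a"
  shows "\<sigma> i < length a" "\<sigma> (\<sigma> i) = i"
  using assms permutes_in_image[of \<sigma> "{..<length a}" i]
  by (auto simp: admissible_def fun_eq_iff)

lemma admissible_parity:
  assumes "admissible a \<sigma>" "i < length a"
  shows "a ! \<sigma> i mod 2 = a ! i mod 2"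
proof -
  note inv = admissible_involution[OF assms]
  consider "a ! i < a ! \<sigma> i" | "a ! \<sigma> i < a ! i" | "a ! \<sigma> i = a ! i" by linarith
  then show ?thesis
  proof cases
    case 1
    then show ?thesis using P_minus_partner_parity[OF assms(1), of i] assms(2) by (simp add: P_minus_def)
  next
    case 2
    then show ?thesis using P_minus_partner_parity[OF assms(1), of "\<sigma> i"] inv by (simp add: P_minus_def)
  qed simp
qed

text \<open>
  At every level \<open>A\<close>, among the indices of weight at most \<open>A\<close> those which are fixed or whose partner
  lies above \<open>A\<close> have distinct parities: the partner of such a \<open>j\<close> would contradict the maximality
  of a fixed index, or coincide with the partner of a second such index by minimality.
\<close>

lemma admissible_open_parity:
  assumes adm: "admissible a \<sigma>" and i: "i < length a" "a ! i \<le> A" "\<sigma> i = i \<or> A < a ! \<sigma> i"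
    and j: "j < length a" "a ! j \<le> A" "\<sigma> j = j \<or> A < a ! \<sigma> j" and "i \<noteq> j"
  shows "a ! i mod 2 \<noteq> a ! j mod 2"
proof
  assume par: "a ! i mod 2 = a ! j mod 2"
  note inv = admissible_involution[OF adm]
  have plus: "\<sigma> k \<in> P_plus a \<sigma>" if "k < length a" "a ! k < a ! \<sigma> k" for k
    using that inv[of k] by (simp add: P_plus_def)
  have mixed: False if "k < length a" "l < length a" "\<sigma> k = k" "a ! k \<le> A" "a ! l \<le> A" "A < a ! \<sigma> l"
    "a ! l mod 2 = a ! k mod 2" for k l
  proof -
    have k: "k \<in> P_zero a \<sigma>" using that by (simp add: P_zero_def)
    have "\<sigma> l \<in> P_plus a \<sigma>" "a ! \<sigma> l mod 2 = a ! k mod 2"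
      using that plus admissible_parity[OF adm] by auto
    moreover have "is_max_of (a ! k) {a ! j | j. j \<in> P_zero a \<sigma> \<union> P_plus a \<sigma> \<and> a ! j mod 2 = a ! k mod 2}"
      using adm k by (simp add: admissible_def)
    ultimately have "a ! \<sigma> l \<le> a ! k" unfolding is_max_of_def by blast
    then show False using that by simp
  qed
  have le: "a ! \<sigma> k \<le> a ! \<sigma> l" if "k < length a" "l < length a" "a ! k \<le> A" "a ! l \<le> A" "A < a ! \<sigma> k" "A < a ! \<sigma> l"
    "a ! l mod 2 = a ! k mod 2" for k l
  proof -
    have "k \<in> P_minus a \<sigma>" using that by (simp add: P_minus_def)
    then have "is_min_of (a ! \<sigma> k) {a ! j | j. j \<in> P_plus a \<sigma> \<and> a ! j > a ! k \<and> a ! j mod 2 = a ! k mod 2}"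
      using adm by (simp add: admissible_def)
    moreover have "\<sigma> l \<in> P_plus a \<sigma>" "a ! k < a ! \<sigma> l" "a ! \<sigma> l mod 2 = a ! k mod 2"
      using that plus admissible_parity[OF adm] by auto
    ultimately show ?thesis unfolding is_min_of_def by blast
  qed
  consider "\<sigma> i = i" "\<sigma> j = j" | "\<sigma> i = i" "A < a ! \<sigma> j" | "A < a ! \<sigma> i" "\<sigma> j = j" | "A < a ! \<sigma> i" "A < a ! \<sigma> j"
    using i(3) j(3) by blast
  then show False
  proof cases
    case 1
    then show False using adm i j \<open>i \<noteq> j\<close> par by (simp add: admissible_def P_zero_def)
  next
    case 2
    then show False using mixed[of i j] i j par by simp
  next
    case 3
    then show False using mixed[of j i] i j par by simp
  next
    case 4
    then have eq: "a ! \<sigma> i = a ! \<sigma> j" using le[of i j] le[of j i] i j par by simp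
    let ?I = "{k. k < length a \<and> a ! k = a ! \<sigma> i}"
    have "?I \<in> blocks a" using inv(1)[OF i(1)] by (auto simp: blocks_def)
    then have "card (P_plus a \<sigma> \<inter> ?I) \<le> 1" using adm unfolding admissible_def by blast
    moreover have "{\<sigma> i, \<sigma> j} \<subseteq> P_plus a \<sigma> \<inter> ?I"
      using plus[of i] plus[of j] 4 i j eq inv(1)[of i] inv(1)[of j] by auto
    then have "card {\<sigma> i, \<sigma> j} \<le> card (P_plus a \<sigma> \<inter> ?I)" by (rule card_mono[rotated]) simp
    ultimately have "card {\<sigma> i, \<sigma> j} \<le> 1" by linarith
    then have "\<sigma> i = \<sigma> j" by (cases "\<sigma> i = \<sigma> j") auto
    then show False using inv(2)[OF i(1)] inv(2)[OF j(1)] \<open>i \<noteq> j\<close> by simp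
  qed
qed

context nonarch_local_field
begin

text \<open>\<open>GK_binary\<close> translates the conditions on binary blocks into valuations; the
  even sum of weights it requires comes from admissibility. An index above its partner is handled by
  symmetry.\<close>

lemma reduced_form_facts:
  assumes a: "length a = n" "\<forall>x\<in>set a. 0 \<le> x" and B: "B \<in> carrier_mat n n" "transpose_mat B = B"
    and adm: "admissible a \<sigma>" and red: "reduced_form v a \<sigma> B"
  shows "form_ge {..<n} (\<lambda>i. real_of_int (a ! i)) (gram B)"
    and "\<And>i. i < n \<Longrightarrow> \<sigma> i \<noteq> i \<Longrightarrow>
      v (pair_disc (gram B) i (\<sigma> i)) = ereal (real_of_int (a ! i) + real_of_int (a ! \<sigma> i))"
    and "\<And>i. i < n \<Longrightarrow> \<sigma> i = i \<or> a ! i < a ! \<sigma> i \<Longrightarrow> v (gram B i i / 2) = ereal (real_of_int (a ! i))"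
    and "\<And>i j. i < n \<Longrightarrow> j < n \<Longrightarrow> j \<noteq> i \<Longrightarrow> j \<noteq> \<sigma> i \<Longrightarrow>
      gt ((real_of_int (a ! i) + real_of_int (a ! j)) / 2) (gram B i j)"
proof -
  note inv = admissible_involution[OF adm, unfolded a(1)]
  have "B \<in> \<M> v a" using red by (simp add: reduced_form_def)
  then show form: "form_ge {..<n} (\<lambda>i. real_of_int (a ! i)) (gram B)"
    using M_iff[OF B a] by simp
  note D = form_geD[OF form]
  have pair: "v (pair_disc (gram B) i (\<sigma> i)) = ereal (real_of_int (a ! i) + real_of_int (a ! \<sigma> i)) \<and>
      (a ! i < a ! \<sigma> i \<longrightarrow> v (B $$ (i, i)) = ereal (real_of_int (a ! i)))"
    if i: "i < n" "\<sigma> i \<noteq> i" "a ! i \<le> a ! \<sigma> i" for i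
  proof -
    let ?G = "pair_submatrix B i (\<sigma> i)"
    have s: "\<sigma> i < n" using inv i by simp
    have G: "nondegenerate ?G" "GK v ?G = [a ! i, a ! \<sigma> i]"
      using red i a(1) by (auto simp: reduced_form_def P_zero_def)
    have lt2: "{..<2::nat} = {0, Suc 0}" by auto
    have "form_ge {..<2} (\<lambda>k. real_of_int ([a ! i, a ! \<sigma> i] ! k)) (gram ?G)"
      using D(1)[of i i] D(1)[of "\<sigma> i" "\<sigma> i"] D(2)[of i "\<sigma> i"] i s
        ge_mult_half[of _ "gram B i i"] ge_mult_half[of _ "gram B (\<sigma> i) (\<sigma> i)"]
      unfolding form_ge_def lt2 by (simp add: gram_def pair_submatrix_index add.commute)
    moreover have "0 \<le> a ! i" using a i by auto
    moreover have "even (a ! i + a ! \<sigma> i)" using admissible_parity[OF adm, of i] a i by presburger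
    ultimately have *: "v (4 * (?G $$ (0, 0) * ?G $$ (1, 1)) - (2 * ?G $$ (0, 1))\<^sup>2) = ereal (real_of_int (a ! i + a ! \<sigma> i))"
      "a ! i < a ! \<sigma> i \<Longrightarrow> v (?G $$ (0, 0)) = ereal (real_of_int (a ! i))"
      using GK_binary[OF pair_submatrix_carrier pair_submatrix_symmetric G(1) _ _ i(3) _ G(2)] by blast+
    have "4 * (?G $$ (0, 0) * ?G $$ (1, 1)) - (2 * ?G $$ (0, 1))\<^sup>2 = pair_disc (gram B) i (\<sigma> i)"
      using D(3)[of "\<sigma> i" i] i s
      by (simp add: pair_disc_def gram_def pair_submatrix_index power2_eq_square)
    then show ?thesis using * by (simp add: pair_submatrix_index)
  qed
  show "v (pair_disc (gram B) i (\<sigma> i)) = ereal (real_of_int (a ! i) + real_of_int (a ! \<sigma> i))"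
    if i: "i < n" "\<sigma> i \<noteq> i" for i
  proof (cases "a ! i \<le> a ! \<sigma> i")
    case True
    then show ?thesis using pair i by blast
  next
    case False
    then have "v (pair_disc (gram B) (\<sigma> i) i) = ereal (real_of_int (a ! \<sigma> i) + real_of_int (a ! i))"
      using pair[of "\<sigma> i"] i inv[of i] a(1) by simp
    then show ?thesis by (simp add: pair_disc_def mult.commute add.commute)
  qed
  show "v (gram B i i / 2) = ereal (real_of_int (a ! i))" if "i < n" "\<sigma> i = i \<or> a ! i < a ! \<sigma> i" for i
    using that pair[of i] red a(1) by (cases "\<sigma> i = i") (auto simp: gram_def reduced_form_def P_zero_def)
  show "gt ((real_of_int (a ! i) + real_of_int (a ! j)) / 2) (gram B i j)"
    if "i < n" "j < n" "j \<noteq> i" "j \<noteq> \<sigma> i" for i j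
    using that red a(1) by (auto simp: gram_def gt_def reduced_form_def)
qed

lemma reduced_form_GK:
  assumes a: "length a = n" "\<forall>x\<in>set a. 0 \<le> x" "sorted a" and B: "B \<in> carrier_mat n n" "transpose_mat B = B"
    and adm: "admissible a \<sigma>" and red: "reduced_form v a \<sigma> B"
  shows "nondegenerate B" "GK v B = a"
proof -
  note R = reduced_form_facts[OF a(1,2) B adm red]
  note inv = admissible_involution[OF adm, unfolded a(1)]
  note par = admissible_parity[OF adm, unfolded a(1)]
  let ?w = "\<lambda>i. real_of_int (a ! i)"
  have even: "even (a ! i + a ! \<sigma> i)" if "i < n" for i using par[OF that] by presburger
  have inv': "\<sigma> i \<in> {..<n} \<and> \<sigma> (\<sigma> i) = i" if "i \<in> {..<n}" for i using inv that by simp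
  have sep: "a ! i mod 2 \<noteq> a ! j mod 2" if "i \<in> {..<n}" "j \<in> {..<n}" "\<sigma> i = i" "\<sigma> j = j" "i \<noteq> j" for i j
    using adm that a(1) by (auto simp: admissible_def P_zero_def)
  \<comment> \<open>With \<open>\<sigma>\<close> itself as pairing, the uncut form is already split;
    this yields nondegeneracy.\<close>
  have "split_form {..<n} ?w \<sigma> (gram B)"
    unfolding split_form_def using R inv by auto
  moreover have "card {i \<in> {..<n}. \<sigma> i = i} \<le> 2"
    by (rule card_distinct_parity_le[of _ "(!) a"]) (use sep in auto)
  moreover have "\<exists>m. (\<Sum>i<n. ?w i) = 2 * real_of_int m + 1" if "card {i \<in> {..<n}. \<sigma> i = i} = 2"
    using even by (intro odd_sum_involution[of "{..<n}" \<sigma> "(!) a", OF _ inv' _ sep that]) auto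
  ultimately have "gdet {..<n} (gram B) \<noteq> 0" by (intro split_form_nonzero) auto
  then show "nondegenerate B" using B by (simp add: gdet_gram nondegenerate_def)
  show "GK v B = a"
  proof (rule GK_eqI)
    have "form_subst B (1\<^sub>m n) = B" using B by (simp add: form_subst_def)
    then show "a \<in> GK_candidates v B"
      unfolding GK_candidates_iff[OF B] using a R(1) one_mem_GL_integers by force
  next
    fix b assume "b \<in> GK_candidates v B"
    then obtain U where b: "length b = n" "sorted b" and U: "U \<in> GL_integers v n"
      "form_ge {..<n} (\<lambda>i. real_of_int (b ! i)) (gram (form_subst B U))"
      using GK_candidates_iff[OF B] by blast
    show "lexordp_eq b a"
    proof (rule ccontr)
      assume "\<not> lexordp_eq b a"
      moreover have "length b = length a" using a(1) b(1) by simp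
      ultimately obtain k where k: "k < length a" "a ! k < b ! k" "\<And>i. i < k \<Longrightarrow> b ! i = a ! i"
        by (rule not_lexordp_eq_obtain) blast
      have kn: "k < n" using k(1) a(1) by simp
      obtain \<pi> where \<pi>: "v \<pi> = ereal (real_of_int (a ! k + 1))" by (rule uniformizer_power)
      interpret truncation v n "(!) a" \<sigma> "gram B" "a ! k" \<pi>
      proof (intro truncation.intro truncation_axioms.intro nonarch_local_field_axioms)
        show "a ! i mod 2 \<noteq> a ! j mod 2"
          if "i < n" "j < n" "i \<noteq> j" "a ! i \<le> a ! k" "a ! j \<le> a ! k" "\<sigma> i = i \<or> a ! k < a ! \<sigma> i"
            "\<sigma> j = j \<or> a ! k < a ! \<sigma> j" for i j
          using admissible_open_parity[OF adm, of i "a ! k" j] that a(1) by simp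
        show "\<sigma> i < n \<and> \<sigma> (\<sigma> i) = i" if "i < n" for i using inv that by simp
      qed (fact R even \<pi>)+
      note GL = GL_integersD[OF U(1)]
      obtain V where V: "\<forall>i<n. \<forall>j<n. ge 0 (V i j)"
        "\<forall>i<n. \<forall>j<n. (\<Sum>r<n. U $$ (i, r) * V r j) = (if i = j then 1 else 0)" using GL(3) by blast
      have "form_ge {..<n} (\<lambda>i. real_of_int (b ! i))
        (\<lambda>k l. \<Sum>r<n. \<Sum>s<n. U $$ (r, k) * gram B r s * U $$ (s, l))"
        using U(2) unfolding form_ge_def by (simp add: gram_form_subst[OF B(1) GL(1)])
      \<comment> \<open>Before \<open>k\<close> the entries agree; from \<open>k\<close> on,
        \<open>b ! i \<ge> b ! k > a ! k\<close>, so the right-hand side is the cut-off value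
        itself.\<close>
      moreover have "min (a ! i) (a ! k + 1) \<le> min (b ! i) (a ! k + 1)" if "i < n" for i
      proof (cases "i < k")
        case False
        then have "b ! k \<le> b ! i" using b that by (intro sorted_nth_mono) auto
        then show ?thesis using k(2) by simp
      qed (simp add: k(3))
      ultimately have "min (b ! k) (a ! k + 1) = min (a ! k) (a ! k + 1)"
        using GL(2) V by (intro candidate_bound[of "\<lambda>i j. U $$ (i, j)" V "(!) b"] kn) auto
      then show False using k(2) by simp
    qed
  qed
qed

end

theorem theorem5p1:
  fixes v :: "'a::field_char_0 \<Rightarrow> ereal" and n :: nat and a :: "int list" and B :: "'a mat"
  assumes "nonarch_local_field v"
    and "length a = n" and "\<forall>x\<in>set a. 0 \<le> x" and "sorted a"
    and "B \<in> half_integral v n"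
    and "reduced_form_of_GK_type v a B"
  shows "nondegenerate B \<and> GK v B = a \<and> optimal v B"
proof -
  interpret nonarch_local_field v by fact
  obtain \<sigma> where \<sigma>: "admissible a \<sigma>" "reduced_form v a \<sigma> B"
    using assms(6) by (auto simp: reduced_form_of_GK_type_def)
  have B: "B \<in> carrier_mat n n" "transpose_mat B = B" using assms(5) by (auto simp: half_integral_def)
  note GK = reduced_form_GK[OF assms(2-4) B \<sigma>]
  have "a \<in> S v B" using assms(2-4) \<sigma>(2) B by (auto simp: S_def reduced_form_def)
  then show ?thesis using GK by (simp add: optimal_def)
qed

end
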